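(* Let $\Bbbk$ be a field of characteristic $0$ and $V$ an $n$-dimensional $\Bbbk$-vector space. For $x\in\mathrm{Lie}(V)$, there are canonical isomorphisms $$T_x\mathrm{Lie}(V)\cong Z^2_{\mathrm{CE}}(V_x,V_x),\qquad T_x(\mathrm{GL}(V)\cdot x)\cong B^2_{\mathrm{CE}}(V_x,V_x),$$ and $$T_{[x]}[\mathrm{Lie}(V)/\mathrm{GL}(V)]\cong H^2_{\mathrm{CE}}(V_x,V_x).$$
   Context: $V^{2,1}=\mathrm{Hom}(V\otimes V,V)$; each $x\in V^{2,1}$ corresponds to a bilinear product $\mu_x$ on $V$ with structure constants $x_{i,j}^\ell$, and $V_x=(V,\mu_x)$. $\mathrm{Leib}(V)\subset V^{2,1}$ is the closed subscheme cut out by the $n^4$ quadratic equations expressing the right Leibniz identity $\mu_x(\mu_x(a,b),c)=\mu_x(\mu_x(a,c),b)+\mu_x(a,\mu_x(b,c))$. $\mathrm{Lie}(V)$ is the closed subscheme of $\mathrm{Leib}(V)$ cut out by the linear equations $x_{i,j}^\ell+x_{j,i}^\ell=0$; it parameterizes Lie brackets on $V$. $\mathrm{GL}(V)$ acts by $(g\cdot\mu)(a,b)=g\,\mu(g^{-1}a,g^{-1}b)$. $Z^2_{\mathrm{CE}}$, $B^2_{\mathrm{CE}}$, $H^2_{\mathrm{CE}}$ denote Chevalley–Eilenberg $2$-cocycles, $2$-coboundaries and second cohomology of the Lie algebra $V_x$ with coefficients in its adjoint module. The tangent space of the quotient stack $[\mathrm{Lie}(V)/\mathrm{GL}(V)]$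 at $[x]$ is $T_x\mathrm{Lie}(V)/T_x(\mathrm{GL}(V)\cdot x)$. *)

theory Defs
  imports
    Complex_Main
    "HOL-Library.Poly_Mapping"
    "HOL-Library.Function_Algebras"
    "HOL-Library.Set_Algebras"
begin

section \<open>Subspaces, quotients and isomorphisms\<close>

text \<open>Vector spaces other than \<open>V\<close> itself are given by a carrier set inside a type carrying a
  pointwise addition, together with a scalar multiplication.  The quotient \<open>W / U\<close> is the set of
  cosets \<open>w +o U\<close>; cosets are added elementwise by \<open>(+)\<close> on sets.  Adding \<open>U\<close> in
  \<open>quot_scale\<close> matters only for the scalar 0.\<close>

definition quot_space :: "'a::plus set \<Rightarrow> 'a set \<Rightarrow> 'a set set" where
  "quot_space W U = (\<lambda>w. w +o U) ` W"

definition quot_scale :: "('k \<Rightarrow> 'a \<Rightarrow> 'a) \<Rightarrow> 'a::plus set \<Rightarrow> 'k \<Rightarrow> 'a set \<Rightarrow> 'a set" where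
  "quot_scale s U c A = s c ` A + U"

definition linear_iso ::
  "('k \<Rightarrow> 'a \<Rightarrow> 'a) \<Rightarrow> 'a::plus set \<Rightarrow> ('k \<Rightarrow> 'b \<Rightarrow> 'b) \<Rightarrow> 'b::plus set \<Rightarrow> ('a \<Rightarrow> 'b) \<Rightarrow> bool" where
  "linear_iso s1 W1 s2 W2 \<phi> \<longleftrightarrow>
     bij_betw \<phi> W1 W2 \<and>
     (\<forall>u\<in>W1. \<forall>v\<in>W1. \<phi> (u + v) = \<phi> u + \<phi> v) \<and>
     (\<forall>c. \<forall>u\<in>W1. \<phi> (s1 c u) = s2 c (\<phi> u))"

section \<open>Polynomials and Zariski tangent spaces\<close>

type_synonym ('i, 'k) mpoly = "('i \<Rightarrow>\<^sub>0 nat) \<Rightarrow>\<^sub>0 'k"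

definition mvar :: "'i \<Rightarrow> ('i, 'k::comm_ring_1) mpoly" where
  "mvar i = Poly_Mapping.single (Poly_Mapping.single i 1) 1"

definition mconst :: "'k::comm_ring_1 \<Rightarrow> ('i, 'k) mpoly" where
  "mconst c = Poly_Mapping.single 0 c"

definition mpoly_eval :: "('i \<Rightarrow> 'k) \<Rightarrow> ('i, 'k::comm_ring_1) mpoly \<Rightarrow> 'k" where
  "mpoly_eval a f =
     (\<Sum>m\<in>Poly_Mapping.keys f.
        Poly_Mapping.lookup f m * (\<Prod>i\<in>Poly_Mapping.keys m. a i ^ Poly_Mapping.lookup m i))"

text \<open>The polynomial ring in the variables indexed by \<open>J\<close>, i.e. the coordinate ring of the affine
  space with coordinates \<open>J\<close>.\<close>

definition mpolys :: "'i set \<Rightarrow> ('i, 'k::comm_ring_1) mpoly set" where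
  "mpolys J = {f. \<forall>m\<in>Poly_Mapping.keys f. Poly_Mapping.keys m \<subseteq> J}"

definition ideal_gen :: "'i set \<Rightarrow> ('i, 'k::comm_ring_1) mpoly set \<Rightarrow> ('i, 'k) mpoly set" where
  "ideal_gen J F = {(\<Sum>f\<in>S. c f * f) | S c. finite S \<and> S \<subseteq> F \<and> (\<forall>f\<in>S. c f \<in> mpolys J)}"

text \<open>The Zariski tangent space at the rational point \<open>a\<close> of the closed subscheme of affine space
  with ideal \<open>I\<close>, i.e. the dual of \<open>m/m\<^sup>2\<close> for the maximal ideal \<open>m\<close> of \<open>a\<close>, as the space of point derivations
  of the coordinate ring modulo \<open>I\<close> at \<open>a\<close>.  Derivations are extended by 0 outside
  \<open>mpolys J\<close>, so that equality of functions is equality of derivations.\<close>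

definition zariski_tangent ::
  "'i set \<Rightarrow> ('i, 'k::field) mpoly set \<Rightarrow> ('i \<Rightarrow> 'k) \<Rightarrow> (('i, 'k) mpoly \<Rightarrow> 'k) set" where
  "zariski_tangent J I a = {D.
     (\<forall>f\<in>mpolys J. \<forall>g\<in>mpolys J. D (f + g) = D f + D g) \<and>
     (\<forall>c. \<forall>f\<in>mpolys J. D (mconst c * f) = c * D f) \<and>
     (\<forall>f\<in>mpolys J. \<forall>g\<in>mpolys J. D (f * g) = mpoly_eval a f * D g + mpoly_eval a g * D f) \<and>
     (\<forall>f\<in>I. D f = 0) \<and>
     (\<forall>f. f \<notin> mpolys J \<longrightarrow> D f = 0)}"

definition tangent_scale :: "'k::field \<Rightarrow> (('i, 'k) mpoly \<Rightarrow> 'k) \<Rightarrow> ('i, 'k) mpoly \<Rightarrow> 'k" where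
  "tangent_scale c D = (\<lambda>f. c * D f)"

section \<open>The affine space of bilinear products\<close>

text \<open>The space \<open>V\<close> is a type \<open>'v\<close> with scalar multiplication \<open>s\<close> and basis
  \<open>e 0, \<dots>, e (n - 1)\<close>.  An element of \<open>Hom(V \<otimes> V, V)\<close> is represented by the
  corresponding bilinear product.\<close>

definition bilinear_map :: "('k::field \<Rightarrow> 'v::ab_group_add \<Rightarrow> 'v) \<Rightarrow> ('v \<Rightarrow> 'v \<Rightarrow> 'v) \<Rightarrow> bool" where
  "bilinear_map s \<mu> \<longleftrightarrow>
     (\<forall>a. Vector_Spaces.linear s s (\<lambda>b. \<mu> a b)) \<and> (\<forall>b. Vector_Spaces.linear s s (\<lambda>a. \<mu> a b))"

definition map2_scale :: "('k \<Rightarrow> 'v \<Rightarrow> 'v) \<Rightarrow> 'k \<Rightarrow> ('v \<Rightarrow> 'v \<Rightarrow> 'v) \<Rightarrow> 'v \<Rightarrow> 'v \<Rightarrow> 'v" where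
  "map2_scale s c \<mu> = (\<lambda>a b. s c (\<mu> a b))"

definition coord ::
  "('k::field \<Rightarrow> 'v::ab_group_add \<Rightarrow> 'v) \<Rightarrow> nat \<Rightarrow> (nat \<Rightarrow> 'v) \<Rightarrow> 'v \<Rightarrow> nat \<Rightarrow> 'k" where
  "coord s n e v i = module.representation s (e ` {..<n}) v (e i)"

text \<open>The index \<open>(i, j, l)\<close> stands for the structure constant \<open>x\<^sub>i\<^sub>,\<^sub>j\<^sup>l\<close>, so that
  \<open>\<mu> (e i) (e j)\<close> is the sum of the \<open>s (x\<^sub>i\<^sub>,\<^sub>j\<^sup>l) (e l)\<close>.\<close>

type_synonym sc_index = "nat \<times> nat \<times> nat"

definition sc_indices :: "nat \<Rightarrow> sc_index set" where
  "sc_indices n = {..<n} \<times> {..<n} \<times> {..<n}"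

definition struct_consts ::
  "('k::field \<Rightarrow> 'v::ab_group_add \<Rightarrow> 'v) \<Rightarrow> nat \<Rightarrow> (nat \<Rightarrow> 'v) \<Rightarrow> ('v \<Rightarrow> 'v \<Rightarrow> 'v) \<Rightarrow> sc_index \<Rightarrow> 'k" where
  "struct_consts s n e \<mu> = (\<lambda>(i, j, l). coord s n e (\<mu> (e i) (e j)) l)"

definition product_of_consts ::
  "('k::field \<Rightarrow> 'v::ab_group_add \<Rightarrow> 'v) \<Rightarrow> nat \<Rightarrow> (nat \<Rightarrow> 'v) \<Rightarrow> (sc_index \<Rightarrow> 'k) \<Rightarrow> 'v \<Rightarrow> 'v \<Rightarrow> 'v" where
  "product_of_consts s n e y =
     (\<lambda>a b. \<Sum>i<n. \<Sum>j<n. \<Sum>l<n. s (coord s n e a i * coord s n e b j * y (i, j, l)) (e l))"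

section \<open>The schemes \<open>Leib(V)\<close> and \<open>Lie(V)\<close> and the orbits\<close>

text \<open>Coefficient of \<open>e l\<close> in the right Leibniz identity
  \<open>\<mu>(\<mu>(a,b),c) = \<mu>(\<mu>(a,c),b) + \<mu>(a,\<mu>(b,c))\<close> for \<open>a = e i\<close>, \<open>b = e j\<close>,
  \<open>c = e k\<close>.\<close>

definition leib_poly :: "nat \<Rightarrow> nat \<Rightarrow> nat \<Rightarrow> nat \<Rightarrow> nat \<Rightarrow> (sc_index, 'k::field) mpoly" where
  "leib_poly n i j k l =
     (\<Sum>m<n. mvar (i, j, m) * mvar (m, k, l))
     - ((\<Sum>m<n. mvar (i, k, m) * mvar (m, j, l)) + (\<Sum>m<n. mvar (j, k, m) * mvar (i, m, l)))"

definition leib_eqs :: "nat \<Rightarrow> (sc_index, 'k::field) mpoly set" where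
  "leib_eqs n = {leib_poly n i j k l | i j k l. i < n \<and> j < n \<and> k < n \<and> l < n}"

definition skew_eqs :: "nat \<Rightarrow> (sc_index, 'k::field) mpoly set" where
  "skew_eqs n = {mvar (i, j, l) + mvar (j, i, l) | i j l. i < n \<and> j < n \<and> l < n}"

definition lie_ideal :: "nat \<Rightarrow> (sc_index, 'k::field) mpoly set" where
  "lie_ideal n = ideal_gen (sc_indices n) (leib_eqs n \<union> skew_eqs n)"

definition Lie_points ::
  "('k::field \<Rightarrow> 'v::ab_group_add \<Rightarrow> 'v) \<Rightarrow> nat \<Rightarrow> (nat \<Rightarrow> 'v) \<Rightarrow> ('v \<Rightarrow> 'v \<Rightarrow> 'v) set" where
  "Lie_points s n e =
     {x. bilinear_map s x \<and> (\<forall>f\<in>lie_ideal n. mpoly_eval (struct_consts s n e x) f = 0)}"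

definition GL :: "('k::field \<Rightarrow> 'v::ab_group_add \<Rightarrow> 'v) \<Rightarrow> ('v \<Rightarrow> 'v) set" where
  "GL s = {g. Vector_Spaces.linear s s g \<and> bij g}"

definition gl_act :: "('v \<Rightarrow> 'v) \<Rightarrow> ('v \<Rightarrow> 'v \<Rightarrow> 'v) \<Rightarrow> 'v \<Rightarrow> 'v \<Rightarrow> 'v" where
  "gl_act g \<mu> = (\<lambda>a b. g (\<mu> (inv g a) (inv g b)))"

text \<open>The orbit \<open>GL(V) \<cdot> x\<close> is a reduced, locally closed subscheme, open in its closure, so its
  tangent space at \<open>x\<close> is that of the closure.  Since the base field is infinite, the rational
  points of \<open>GL(V)\<close> are dense, and the ideal of the closure consists of the polynomials vanishing
  at all \<open>gl_act g x\<close>.\<close>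

definition orbit_ideal ::
  "('k::field \<Rightarrow> 'v::ab_group_add \<Rightarrow> 'v) \<Rightarrow> nat \<Rightarrow> (nat \<Rightarrow> 'v) \<Rightarrow> ('v \<Rightarrow> 'v \<Rightarrow> 'v)
     \<Rightarrow> (sc_index, 'k) mpoly set" where
  "orbit_ideal s n e x =
     {f \<in> mpolys (sc_indices n). \<forall>g\<in>GL s. mpoly_eval (struct_consts s n e (gl_act g x)) f = 0}"

definition tangent_Lie ::
  "('k::field \<Rightarrow> 'v::ab_group_add \<Rightarrow> 'v) \<Rightarrow> nat \<Rightarrow> (nat \<Rightarrow> 'v) \<Rightarrow> ('v \<Rightarrow> 'v \<Rightarrow> 'v)
     \<Rightarrow> ((sc_index, 'k) mpoly \<Rightarrow> 'k) set" where
  "tangent_Lie s n e x = zariski_tangent (sc_indices n) (lie_ideal n) (struct_consts s n e x)"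

definition tangent_orbit ::
  "('k::field \<Rightarrow> 'v::ab_group_add \<Rightarrow> 'v) \<Rightarrow> nat \<Rightarrow> (nat \<Rightarrow> 'v) \<Rightarrow> ('v \<Rightarrow> 'v \<Rightarrow> 'v)
     \<Rightarrow> ((sc_index, 'k) mpoly \<Rightarrow> 'k) set" where
  "tangent_orbit s n e x =
     zariski_tangent (sc_indices n) (orbit_ideal s n e x) (struct_consts s n e x)"

text \<open>Tangent space of the quotient stack \<open>[Lie(V)/GL(V)]\<close> at \<open>[x]\<close>.\<close>

definition tangent_stack ::
  "('k::field \<Rightarrow> 'v::ab_group_add \<Rightarrow> 'v) \<Rightarrow> nat \<Rightarrow> (nat \<Rightarrow> 'v) \<Rightarrow> ('v \<Rightarrow> 'v \<Rightarrow> 'v)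
     \<Rightarrow> ((sc_index, 'k) mpoly \<Rightarrow> 'k) set set" where
  "tangent_stack s n e x = quot_space (tangent_Lie s n e x) (tangent_orbit s n e x)"

text \<open>A derivation \<open>D\<close> corresponds to the tangent vector of \<open>Hom(V \<otimes> V, V)\<close> whose structure
  constants are the values of \<open>D\<close> on the coordinate functions.\<close>

definition tangent_to_map2 ::
  "('k::field \<Rightarrow> 'v::ab_group_add \<Rightarrow> 'v) \<Rightarrow> nat \<Rightarrow> (nat \<Rightarrow> 'v)
     \<Rightarrow> ((sc_index, 'k) mpoly \<Rightarrow> 'k) \<Rightarrow> 'v \<Rightarrow> 'v \<Rightarrow> 'v" where
  "tangent_to_map2 s n e D = product_of_consts s n e (\<lambda>t. D (mvar t))"

section \<open>Chevalley--Eilenberg cohomology with adjoint coefficients\<close>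

text \<open>Cochains of degree 1, 2 are linear, respectively alternating bilinear maps; \<open>x\<close> is the
  Lie bracket.\<close>

definition CE_C1 :: "('k::field \<Rightarrow> 'v::ab_group_add \<Rightarrow> 'v) \<Rightarrow> ('v \<Rightarrow> 'v) set" where
  "CE_C1 s = {f. Vector_Spaces.linear s s f}"

definition CE_C2 :: "('k::field \<Rightarrow> 'v::ab_group_add \<Rightarrow> 'v) \<Rightarrow> ('v \<Rightarrow> 'v \<Rightarrow> 'v) set" where
  "CE_C2 s = {f. bilinear_map s f \<and> (\<forall>a. f a a = 0)}"

definition CE_d1 :: "('v::ab_group_add \<Rightarrow> 'v \<Rightarrow> 'v) \<Rightarrow> ('v \<Rightarrow> 'v) \<Rightarrow> 'v \<Rightarrow> 'v \<Rightarrow> 'v" where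
  "CE_d1 x f = (\<lambda>a b. x a (f b) - x b (f a) - f (x a b))"

definition CE_d2 :: "('v::ab_group_add \<Rightarrow> 'v \<Rightarrow> 'v) \<Rightarrow> ('v \<Rightarrow> 'v \<Rightarrow> 'v) \<Rightarrow> 'v \<Rightarrow> 'v \<Rightarrow> 'v \<Rightarrow> 'v" where
  "CE_d2 x f = (\<lambda>a b c.
     x a (f b c) - x b (f a c) + x c (f a b) - f (x a b) c + f (x a c) b - f (x b c) a)"

definition CE_Z2 ::
  "('k::field \<Rightarrow> 'v::ab_group_add \<Rightarrow> 'v) \<Rightarrow> ('v \<Rightarrow> 'v \<Rightarrow> 'v) \<Rightarrow> ('v \<Rightarrow> 'v \<Rightarrow> 'v) set" where
  "CE_Z2 s x = {f \<in> CE_C2 s. \<forall>a b c. CE_d2 x f a b c = 0}"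

definition CE_B2 ::
  "('k::field \<Rightarrow> 'v::ab_group_add \<Rightarrow> 'v) \<Rightarrow> ('v \<Rightarrow> 'v \<Rightarrow> 'v) \<Rightarrow> ('v \<Rightarrow> 'v \<Rightarrow> 'v) set" where
  "CE_B2 s x = CE_d1 x ` CE_C1 s"

definition CE_H2 ::
  "('k::field \<Rightarrow> 'v::ab_group_add \<Rightarrow> 'v) \<Rightarrow> ('v \<Rightarrow> 'v \<Rightarrow> 'v) \<Rightarrow> ('v \<Rightarrow> 'v \<Rightarrow> 'v) set set" where
  "CE_H2 s x = quot_space (CE_Z2 s x) (CE_B2 s x)"

end

theory Submission
  imports Defs "Jordan_Normal_Form.Determinant" "HOL-Computational_Algebra.Fraction_Field"
    "HOL-Library.Nat_Bijection"
begin

text \<open>Point derivations on the polynomial ring are determined by their values on the coordinates, so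
  they are the bilinear maps.  Such a derivation kills the ideal of \<open>Lie(V)\<close> iff the bilinear map
  solves the linearised equations, which for a skew map are the cocycle equations.

  A coboundary is tangent to the orbit because it is, up to a multiple of \<open>x\<close>, the velocity of the
  polynomial curve \<open>adj(1 + t f) x((1 + t f) -, (1 + t f) -)\<close>, whose points lie on the orbit for almost
  all \<open>t\<close>; and \<open>x\<close> itself is tangent since the orbit is stable under nonzero scalars.

  Conversely let \<open>D\<close> be tangent to the orbit, and let \<open>y = g \<cdot> x\<close> with \<open>g\<close> a generic group
  element, over the field \<open>L\<close> of rational functions in its entries.  Translating \<open>D\<close> gives a
  derivation from \<open>k[y]\<close> to \<open>L\<close> sending \<open>y\<close> to \<open>g \<cdot> D\<close>; it is well defined because rational
  points are dense.  In characteristic 0 it extends to a derivation of \<open>L\<close>.  Applying the extension to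
  \<open>y = g \<cdot> x\<close> and translating back by \<open>g\<^sup>-\<^sup>1\<close> displays \<open>D\<close> as a coboundary with
  coefficients in \<open>L\<close>, and a linear projection \<open>L \<rightarrow> k\<close> brings it down to the base field.\<close>

section \<open>Evaluation of polynomials along ring homomorphisms\<close>

definition mon_eval :: "('i \<Rightarrow> 'r::comm_ring_1) \<Rightarrow> ('i \<Rightarrow>\<^sub>0 nat) \<Rightarrow> 'r" where
  "mon_eval a m = (\<Prod>i\<in>Poly_Mapping.keys m. a i ^ Poly_Mapping.lookup m i)"

text \<open>The coefficient map is a parameter, so that one formula serves ordinary evaluation,
  substitution of polynomials through \<open>mconst\<close>, evaluation along curves and evaluation
  in dual numbers.\<close>

definition mpoly_hom ::
  "('k::comm_ring_1 \<Rightarrow> 'r::comm_ring_1) \<Rightarrow> ('i \<Rightarrow> 'r) \<Rightarrow> ('i, 'k) mpoly \<Rightarrow> 'r" where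
  "mpoly_hom \<kappa> a f =
     (\<Sum>m\<in>Poly_Mapping.keys f. \<kappa> (Poly_Mapping.lookup f m) * mon_eval a m)"

lemma mpoly_eval_eq_hom: "mpoly_eval a = mpoly_hom (\<lambda>c. c) a"
  by (simp add: fun_eq_iff mpoly_eval_def mpoly_hom_def mon_eval_def)

lemma mon_eval_superset:
  assumes "finite A" "Poly_Mapping.keys m \<subseteq> A"
  shows "mon_eval a m = (\<Prod>i\<in>A. a i ^ Poly_Mapping.lookup m i)"
  unfolding mon_eval_def
  by (rule prod.mono_neutral_left) (use assms in \<open>auto simp: in_keys_iff\<close>)

lemma mon_eval_add: "mon_eval a (m + m') = mon_eval a m * mon_eval a m'"
proof -
  let ?A = "Poly_Mapping.keys m \<union> Poly_Mapping.keys m'"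
  have "Poly_Mapping.keys (m + m') \<subseteq> ?A" by (rule Poly_Mapping.keys_add)
  then show ?thesis
    by (simp add: mon_eval_superset[of ?A] lookup_add power_add prod.distrib)
qed

lemma mon_eval_zero [simp]: "mon_eval a 0 = 1"
  by (simp add: mon_eval_def)

lemma mon_eval_single [simp]: "mon_eval a (Poly_Mapping.single i k) = a i ^ k"
  by (cases "k = 0") (simp_all add: mon_eval_def)

lemma mpoly_eq_sum_single:
  "f = (\<Sum>m\<in>Poly_Mapping.keys f. Poly_Mapping.single m (Poly_Mapping.lookup f m))"
  by (rule poly_mapping_eqI)
    (auto simp: lookup_sum lookup_single when_def in_keys_iff sum.delta)

lemma mpolys_mvar: "i \<in> J \<Longrightarrow> mvar i \<in> mpolys J"
  by (auto simp: mpolys_def mvar_def)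

lemma mpolys_mconst: "mconst c \<in> mpolys J"
  by (auto simp: mpolys_def mconst_def)

lemma mpolys_add: "f \<in> mpolys J \<Longrightarrow> g \<in> mpolys J \<Longrightarrow> f + g \<in> mpolys J"
  using Poly_Mapping.keys_add[of f g] by (fastforce simp: mpolys_def)

lemma mpolys_mult: "f \<in> mpolys J \<Longrightarrow> g \<in> mpolys J \<Longrightarrow> f * g \<in> mpolys J"
  unfolding mpolys_def
proof clarsimp
  fix m i
  assume f: "\<forall>m\<in>Poly_Mapping.keys f. Poly_Mapping.keys m \<subseteq> J"
    and g: "\<forall>m\<in>Poly_Mapping.keys g. Poly_Mapping.keys m \<subseteq> J"
    and m: "m \<in> Poly_Mapping.keys (f * g)" and i: "i \<in> Poly_Mapping.keys m"
  from m keys_mult[of f g] obtain m1 m2 where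
    "m = m1 + m2" "m1 \<in> Poly_Mapping.keys f" "m2 \<in> Poly_Mapping.keys g" by auto
  with i f g Poly_Mapping.keys_add[of m1 m2] show "i \<in> J" by blast
qed

lemma mconst_0 [simp]: "mconst 0 = 0"
  and mconst_1 [simp]: "mconst 1 = 1"
  by (simp_all add: mconst_def)

lemma mconst_add: "mconst (c + d) = mconst c + mconst d"
  and mconst_mult: "mconst (c * d) = mconst c * mconst d"
  by (simp_all add: mconst_def single_add mult_single)

lemma comm_ring_hom_mconst: "comm_ring_hom mconst"
  by unfold_locales (simp_all add: mconst_add mconst_mult)

lemma mpolys_sum: "(\<And>i. i \<in> A \<Longrightarrow> f i \<in> mpolys J) \<Longrightarrow> sum f A \<in> mpolys J"
  by (induction A rule: infinite_finite_induct)
    (auto intro: mpolys_add simp: mpolys_mconst[of 0, simplified])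

lemma mpolys_uminus: "f \<in> mpolys J \<Longrightarrow> - f \<in> mpolys J"
  by (auto simp: mpolys_def in_keys_iff)

lemma mpolys_diff: "f \<in> mpolys J \<Longrightarrow> g \<in> mpolys J \<Longrightarrow> f - g \<in> mpolys J"
  using mpolys_add[OF _ mpolys_uminus] by fastforce

lemma mpolys_UNIV [simp]: "f \<in> mpolys UNIV"
  by (simp add: mpolys_def)

text \<open>Powers of variables, monomials, single terms and finite sums of terms are reached in
  this order. Membership in \<open>mpolys J\<close> is carried along with \<open>P\<close>, since
  the \<open>add\<close> and \<open>mult\<close> cases assume it.\<close>

lemma mpolys_induct [consumes 1, case_names const var add mult]:
  assumes f: "f \<in> mpolys J"
    and const: "\<And>c. P (mconst c)"
    and var: "\<And>i. i \<in> J \<Longrightarrow> P (mvar i)"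
    and add: "\<And>f g. f \<in> mpolys J \<Longrightarrow> g \<in> mpolys J \<Longrightarrow> P f \<Longrightarrow> P g \<Longrightarrow> P (f + g)"
    and mult: "\<And>f g. f \<in> mpolys J \<Longrightarrow> g \<in> mpolys J \<Longrightarrow> P f \<Longrightarrow> P g \<Longrightarrow> P (f * g)"
  shows "P f"
proof -
  let ?P = "\<lambda>f. f \<in> mpolys J \<and> P f"
  have pow: "?P (Poly_Mapping.single (Poly_Mapping.single i k) 1)" if "i \<in> J" for i k
  proof (induction k)
    case 0
    then show ?case using const[of 1] mpolys_mconst[of 1] by (simp add: mconst_def)
  next
    case (Suc k)
    have eq: "Poly_Mapping.single (Poly_Mapping.single i (Suc k)) 1
        = mvar i * Poly_Mapping.single (Poly_Mapping.single i k) 1"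
      by (simp add: mvar_def mult_single flip: single_add)
    show ?case unfolding eq using Suc that by (auto intro: mult mpolys_mult mpolys_mvar var)
  qed
  have mono: "?P (Poly_Mapping.single m 1)" if "Poly_Mapping.keys m \<subseteq> J" for m
  proof -
    have eq: "m = (\<Sum>i\<in>Poly_Mapping.keys m. Poly_Mapping.single i (Poly_Mapping.lookup m i))"
      by (rule poly_mapping_eqI)
        (auto simp: lookup_sum lookup_single when_def in_keys_iff sum.delta)
    have "?P (Poly_Mapping.single (\<Sum>i\<in>A. Poly_Mapping.single i (Poly_Mapping.lookup m i)) 1)"
      if "finite A" "A \<subseteq> J" for A
      using that
    proof (induction A rule: finite_induct)
      case empty
      then show ?case using const[of 1] mpolys_mconst[of 1] by (simp add: mconst_def)
    next
      case (insert i A)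
      have eq: "Poly_Mapping.single (\<Sum>i\<in>insert i A. Poly_Mapping.single i (Poly_Mapping.lookup m
          i)) 1
          = Poly_Mapping.single (Poly_Mapping.single i (Poly_Mapping.lookup m i)) 1
            * Poly_Mapping.single (\<Sum>i\<in>A. Poly_Mapping.single i (Poly_Mapping.lookup m i)) (1::'b)"
        using insert by (simp add: mult_single)
      show ?case unfolding eq using insert pow[of i "Poly_Mapping.lookup m i"]
        by (auto intro!: mult mpolys_mult)
    qed
    from this[OF finite_keys that] show ?thesis using eq by simp
  qed
  have single: "?P (Poly_Mapping.single m c)" if "Poly_Mapping.keys m \<subseteq> J" for m c
  proof -
    have "Poly_Mapping.single m c = mconst c * Poly_Mapping.single m 1"
      by (simp add: mconst_def mult_single)
    then show ?thesis using mono[OF that] const mpolys_mconst by (auto intro: mult mpolys_mult)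
  qed
  have "?P (\<Sum>m\<in>A. Poly_Mapping.single m (Poly_Mapping.lookup f m))"
    if "finite A" "A \<subseteq> Poly_Mapping.keys f" for A
    using that
  proof (induction A rule: finite_induct)
    case empty
    then show ?case using const[of 0] mpolys_mconst[of 0] by simp
  next
    case (insert m A)
    then have "Poly_Mapping.keys m \<subseteq> J" using f by (auto simp: mpolys_def)
    from single[OF this] insert show ?case by (auto intro!: add mpolys_add)
  qed
  from this[OF finite_keys subset_refl] show ?thesis
    using mpoly_eq_sum_single[of f] by simp
qed

context comm_ring_hom
begin

lemma mpoly_hom_superset:
  assumes "finite A" "Poly_Mapping.keys f \<subseteq> A"
  shows "mpoly_hom hom a f = (\<Sum>m\<in>A. hom (Poly_Mapping.lookup f m) * mon_eval a m)"
  unfolding mpoly_hom_def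
  by (rule sum.mono_neutral_left) (use assms in \<open>auto simp: in_keys_iff\<close>)

lemma mpoly_hom_add: "mpoly_hom hom a (f + g) = mpoly_hom hom a f + mpoly_hom hom a g"
proof -
  let ?A = "Poly_Mapping.keys f \<union> Poly_Mapping.keys g"
  have "Poly_Mapping.keys (f + g) \<subseteq> ?A" by (rule Poly_Mapping.keys_add)
  then show ?thesis
    by (simp add: mpoly_hom_superset[of ?A] lookup_add hom_add distrib_right sum.distrib)
qed

lemma mpoly_hom_single [simp]: "mpoly_hom hom a (Poly_Mapping.single m c) = hom c * mon_eval a m"
  by (cases "c = 0") (simp_all add: mpoly_hom_def)

lemma mpoly_hom_zero [simp]: "mpoly_hom hom a 0 = 0"
  by (simp add: mpoly_hom_def)

lemma mpoly_hom_sum: "mpoly_hom hom a (sum f A) = (\<Sum>i\<in>A. mpoly_hom hom a (f i))"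
  by (induction A rule: infinite_finite_induct) (auto simp: mpoly_hom_add)

lemma mpoly_hom_mult: "mpoly_hom hom a (f * g) = mpoly_hom hom a f * mpoly_hom hom a g"
proof -
  have "f * g = (\<Sum>m\<in>Poly_Mapping.keys f. Poly_Mapping.single m (Poly_Mapping.lookup f m)) *
      (\<Sum>m\<in>Poly_Mapping.keys g. Poly_Mapping.single m (Poly_Mapping.lookup g m))"
    using mpoly_eq_sum_single[of f] mpoly_eq_sum_single[of g] by simp
  also have "mpoly_hom hom a \<dots> = mpoly_hom hom a f * mpoly_hom hom a g"
    unfolding mpoly_hom_def[of hom a f] mpoly_hom_def[of hom a g]
    by (simp add: sum_product mpoly_hom_sum mult_single mon_eval_add hom_mult ac_simps)
  finally show ?thesis .
qed

lemma mpoly_hom_mconst [simp]: "mpoly_hom hom a (mconst c) = hom c"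
  by (simp add: mconst_def)

lemma mpoly_hom_mvar [simp]: "mpoly_hom hom a (mvar i) = a i"
  by (simp add: mvar_def)

lemma comm_ring_hom_mpoly_hom: "comm_ring_hom (mpoly_hom hom a)"
  using mpoly_hom_mconst[of a 1] 
  by unfold_locales (simp_all add: mpoly_hom_add mpoly_hom_mult del: mpoly_hom_mconst)

end

lemma comm_ring_hom_ident: "comm_ring_hom (\<lambda>c. c)"
  by unfold_locales simp_all

lemma comm_ring_hom_comp:
  assumes "comm_ring_hom f" "comm_ring_hom g"
  shows "comm_ring_hom (\<lambda>c. f (g c))"
proof -
  interpret f: comm_ring_hom f by fact
  interpret g: comm_ring_hom g by fact
  show ?thesis by unfold_locales (simp_all add: f.hom_add g.hom_add f.hom_mult g.hom_mult)
qed

lemmas mpoly_eval_simps =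
  comm_ring_hom.mpoly_hom_add[OF comm_ring_hom_ident, folded mpoly_eval_eq_hom]
  comm_ring_hom.mpoly_hom_mult[OF comm_ring_hom_ident, folded mpoly_eval_eq_hom]
  comm_ring_hom.mpoly_hom_sum[OF comm_ring_hom_ident, folded mpoly_eval_eq_hom]
  comm_ring_hom.mpoly_hom_mconst[OF comm_ring_hom_ident, folded mpoly_eval_eq_hom]
  comm_ring_hom.mpoly_hom_mvar[OF comm_ring_hom_ident, folded mpoly_eval_eq_hom]
  comm_ring_hom.mpoly_hom_single[OF comm_ring_hom_ident, folded mpoly_eval_eq_hom]

lemma comm_ring_hom_mpoly_eval: "comm_ring_hom (mpoly_eval a)"
  unfolding mpoly_eval_eq_hom by (rule comm_ring_hom.comm_ring_hom_mpoly_hom[OF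
      comm_ring_hom_ident])

lemma mpoly_hom_cong:
  assumes "f \<in> mpolys J" "\<And>i. i \<in> J \<Longrightarrow> a i = b i"
  shows "mpoly_hom \<kappa> a f = mpoly_hom \<kappa> b f"
proof -
  have "mon_eval a m = mon_eval b m" if "m \<in> Poly_Mapping.keys f" for m
    unfolding mon_eval_def
  proof (rule prod.cong[OF refl])
    fix i assume "i \<in> Poly_Mapping.keys m"
    with that assms(1) have "i \<in> J" unfolding mpolys_def by blast
    then show "a i ^ Poly_Mapping.lookup m i = b i ^ Poly_Mapping.lookup m i"
      by (simp only: assms(2))
  qed
  then show ?thesis unfolding mpoly_hom_def by (intro sum.cong refl) (simp only:)
qed

text \<open>Naturality of evaluation. It justifies specialising a generic identity at a point, at a
  parameter value of a curve, or to constant terms.\<close>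

lemma hom_mpoly_hom:
  assumes "comm_ring_hom \<eta>" "comm_ring_hom \<kappa>"
  shows "\<eta> (mpoly_hom \<kappa> a f) = mpoly_hom (\<lambda>c. \<eta> (\<kappa> c)) (\<lambda>i. \<eta> (a i)) f"
proof -
  interpret \<eta>: comm_ring_hom \<eta> by fact
  show ?thesis
    unfolding mpoly_hom_def mon_eval_def \<eta>.hom_sum \<eta>.hom_mult \<eta>.hom_prod \<eta>.hom_power ..
qed

text \<open>The induction step views \<open>f\<close> as a univariate polynomial in the new variable;
  \<open>del m\<close> is the monomial \<open>m\<close> with that variable removed.\<close>

lemma mpoly_eq_0_if_vanishing:
  fixes f :: "('i, 'k::field_char_0) mpoly"
  assumes "finite J" "f \<in> mpolys J" "\<And>a. mpoly_eval a f = 0"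
  shows "f = 0"
  using assms
proof (induction J arbitrary: f rule: finite_induct)
  case empty
  have "Poly_Mapping.keys f \<subseteq> {0}" using empty(1) by (auto simp: mpolys_def)
  then have "Poly_Mapping.lookup f 0 = 0"
    using empty(2)[of "\<lambda>_. 0"] comm_ring_hom.mpoly_hom_superset[OF comm_ring_hom_ident, of "{0}" f]
    by (simp add: mpoly_eval_eq_hom)
  with \<open>Poly_Mapping.keys f \<subseteq> {0}\<close> show ?case
    by (metis in_keys_iff keys_eq_empty subset_singletonD singletonI)
next
  case (insert i J)
  define del where "del m = m - Poly_Mapping.single i (Poly_Mapping.lookup m i)" for m ::
      "'i \<Rightarrow>\<^sub>0 nat"
  have lookup_del: "Poly_Mapping.lookup (del m) j = (if j
      = i then 0 else Poly_Mapping.lookup m j)" for m j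
    by (simp add: del_def lookup_minus lookup_single when_def)
  have del: "m = Poly_Mapping.single i (Poly_Mapping.lookup m i) + del m" for m
    by (rule poly_mapping_eqI) (auto simp: lookup_add lookup_del lookup_single when_def)
  have mon_upd: "mon_eval (a(i := t)) m = t ^ Poly_Mapping.lookup m i * mon_eval a (del m)"
    for a :: "'i \<Rightarrow> 'k" and t m
  proof -
    have "i \<notin> Poly_Mapping.keys (del m)" by (simp add: in_keys_iff lookup_del)
    then have "mon_eval (a(i := t)) (del m) = mon_eval a (del m)"
      unfolding mon_eval_def by (intro prod.cong) auto
    then show ?thesis by (subst del) (simp add: mon_eval_add)
  qed
  \<comment> \<open>\<open>fd d\<close> is the coefficient of the \<open>d\<close>-th power of the
    variable \<open>i\<close>, a polynomial in the variables \<open>J\<close>.\<close>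
  define fd where "fd d = (\<Sum>m | m \<in> Poly_Mapping.keys f \<and> Poly_Mapping.lookup m i = d.
      Poly_Mapping.single (del m) (Poly_Mapping.lookup f m))" for d
  have fd0: "fd d = 0" for d
  proof (rule insert.IH)
    have "Poly_Mapping.keys (del m) \<subseteq> J" if "m \<in> Poly_Mapping.keys f" for m
    proof
      fix j assume "j \<in> Poly_Mapping.keys (del m)"
      then have "j \<noteq> i" "j \<in> Poly_Mapping.keys m" by (auto simp: in_keys_iff lookup_del split:
          if_splits)
      moreover have "Poly_Mapping.keys m \<subseteq> insert i J"
        using that insert.prems(1) unfolding mpolys_def by blast
      ultimately show "j \<in> J" by blast
    qed
    then have "Poly_Mapping.single (del m) (Poly_Mapping.lookup f m) \<in> mpolys J"
      if "m \<in> Poly_Mapping.keys f" for m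
      using that by (auto simp: mpolys_def)
    then show "fd d \<in> mpolys J" unfolding fd_def by (auto intro!: mpolys_sum)
  next
    fix a :: "'i \<Rightarrow> 'k"
    let ?p = "\<Sum>m\<in>Poly_Mapping.keys f.
      Polynomial.monom (Poly_Mapping.lookup f m * mon_eval a (del m)) (Poly_Mapping.lookup m i)"
    have "poly ?p t = mpoly_eval (a(i := t)) f" for t
      by (simp add: mpoly_eval_eq_hom mpoly_hom_def mon_upd poly_sum poly_monom ac_simps)
    \<comment> \<open>A univariate polynomial that vanishes at every element of an infinite field is
      zero.\<close>
    then have "?p = 0" using insert.prems(2) by (simp flip: poly_all_0_iff_0)
    then have "Polynomial.coeff ?p d = 0" by simp
    then show "mpoly_eval a (fd d) = 0"
      by (simp add: coeff_sum fd_def mpoly_eval_simps sum.If_cases Int_def)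
  qed
  have "Poly_Mapping.lookup f m = 0" if m: "m \<in> Poly_Mapping.keys f" for m
  proof -
    \<comment> \<open>\<open>del\<close> is injective on monomials with a fixed exponent of
      \<open>i\<close>, so no two terms merge in \<open>fd\<close> and each coefficient of
      \<open>f\<close> survives.\<close>
    have "del m' = del m \<longleftrightarrow> m' = m" if "Poly_Mapping.lookup m' i = Poly_Mapping.lookup m i" for m'
      using that del[of m] del[of m'] by metis
    then have "Poly_Mapping.lookup (fd (Poly_Mapping.lookup m i)) (del m) =
      (\<Sum>m' | m' \<in> Poly_Mapping.keys f \<and> Poly_Mapping.lookup m' i = Poly_Mapping.lookup m i.
        if m' = m then Poly_Mapping.lookup f m else 0)"
      unfolding fd_def lookup_sum by (intro sum.cong) (auto simp: lookup_single when_def)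
    also have "\<dots> = Poly_Mapping.lookup f m" using m by (simp add: sum.delta)
    finally show ?thesis by (simp add: fd0)
  qed
  then show ?case by (metis in_keys_iff keys_eq_empty equals0I)
qed

text \<open>A single polynomial involves only finitely many variables, so the type of variables may
  be infinite.\<close>

corollary mpoly_eq_0I:
  fixes f :: "('i, 'k::field_char_0) mpoly"
  assumes "\<And>a. mpoly_eval a f = 0"
  shows "f = 0"
  by (rule mpoly_eq_0_if_vanishing[of "\<Union>m\<in>Poly_Mapping.keys f. Poly_Mapping.keys m"])
    (auto simp: mpolys_def assms)

lemma mpolys_subst:
  assumes "f \<in> mpolys I" "\<And>i. i \<in> I \<Longrightarrow> \<sigma> i \<in> mpolys J"
  shows "mpoly_hom mconst \<sigma> f \<in> mpolys J"
  using assms(1)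
  by (induction f rule: mpolys_induct)
    (simp_all add: comm_ring_hom.mpoly_hom_mconst[OF comm_ring_hom_mconst]
      comm_ring_hom.mpoly_hom_mvar[OF comm_ring_hom_mconst]
      comm_ring_hom.mpoly_hom_add[OF comm_ring_hom_mconst]
      comm_ring_hom.mpoly_hom_mult[OF comm_ring_hom_mconst]
      mpolys_mconst mpolys_add mpolys_mult assms(2))

section \<open>Tangent vectors as dual number evaluations\<close>

text \<open>The coefficients 0 and 1 of a univariate polynomial model its class in the dual numbers.\<close>

definition dual_eval ::
  "('k::comm_ring_1 \<Rightarrow> 'r::comm_ring_1) \<Rightarrow> ('i \<Rightarrow> 'r) \<Rightarrow> ('i \<Rightarrow> 'r) \<Rightarrow> ('i, 'k) mpoly \<Rightarrow> 'r" where
  "dual_eval \<kappa> a v f = Polynomial.coeff (mpoly_hom (\<lambda>c. [:\<kappa> c:]) (\<lambda>i. [:a i, v i:]) f) 1"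

lemma comm_ring_hom_pCons: "comm_ring_hom (\<lambda>c. [:c:])"
  by unfold_locales (simp_all add: one_pCons)

lemma comm_ring_hom_coeff_0: "comm_ring_hom (\<lambda>p. Polynomial.coeff p 0)"
  by unfold_locales (simp_all add: coeff_mult)

lemma coeff_mult_1:
  "Polynomial.coeff (p * q) 1 =
     Polynomial.coeff p 0 * Polynomial.coeff q 1 + Polynomial.coeff p 1 * Polynomial.coeff q 0"
  by (simp add: coeff_mult)

context comm_ring_hom
begin

lemma dual_eval_hom: "comm_ring_hom (\<lambda>c. [:hom c:])"
  by (rule comm_ring_hom_comp[OF comm_ring_hom_pCons comm_ring_hom_axioms])

lemma dual_eval_coeff_0:
  "Polynomial.coeff (mpoly_hom (\<lambda>c. [:hom c:]) p f) 0 = mpoly_hom hom (\<lambda>i. Polynomial.coeff (p i)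
      0) f"
  by (simp add: hom_mpoly_hom[OF comm_ring_hom_coeff_0 dual_eval_hom])

lemma dual_eval_add: "dual_eval hom a v (f + g) = dual_eval hom a v f + dual_eval hom a v g"
  by (simp add: dual_eval_def comm_ring_hom.mpoly_hom_add[OF dual_eval_hom])

lemma dual_eval_mult:
  "dual_eval hom a v (f * g) = mpoly_hom hom a f * dual_eval hom a v g
      + mpoly_hom hom a g * dual_eval hom a v f"
  unfolding dual_eval_def comm_ring_hom.mpoly_hom_mult[OF dual_eval_hom] coeff_mult_1
  by (simp add: dual_eval_coeff_0)

lemma dual_eval_mconst [simp]: "dual_eval hom a v (mconst c) = 0"
  by (simp add: dual_eval_def comm_ring_hom.mpoly_hom_mconst[OF dual_eval_hom] coeff_pCons)

lemma dual_eval_mvar [simp]: "dual_eval hom a v (mvar i) = v i"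
  by (simp add: dual_eval_def comm_ring_hom.mpoly_hom_mvar[OF dual_eval_hom])

lemma dual_eval_diff: "dual_eval hom a v (f - g) = dual_eval hom a v f - dual_eval hom a v g"
  using dual_eval_add[of a v "f - g" g] by (simp add: algebra_simps)

lemma dual_eval_sum: "dual_eval hom a v (sum f A) = (\<Sum>i\<in>A. dual_eval hom a v (f i))"
  using dual_eval_mconst[of a v 0]
  by (induction A rule: infinite_finite_induct) (auto simp: dual_eval_add simp del:
      dual_eval_mconst)

text \<open>Linearity in the tangent direction. It later removes the multiple of \<open>x\<close>
  from the velocity of a curve in the orbit.\<close>

lemma dual_eval_add_smult:
  "dual_eval hom a (\<lambda>i. v i + c * w i) f = dual_eval hom a v f + c * dual_eval hom a w f"
proof -
  have "f \<in> mpolys UNIV" by simp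
  then show ?thesis
    by (induction f rule: mpolys_induct) (simp_all add: dual_eval_add dual_eval_mult algebra_simps)
qed

lemma hom_dual_eval:
  assumes "comm_ring_hom \<eta>"
  shows "\<eta> (dual_eval hom a v f) = dual_eval (\<lambda>c. \<eta> (hom c)) (\<lambda>i. \<eta> (a i)) (\<lambda>i. \<eta> (v i)) f"
proof -
  interpret \<eta>: comm_ring_hom \<eta> by fact
  interpret \<eta>': comm_ring_hom "\<lambda>c. \<eta> (hom c)"
    by (rule comm_ring_hom_comp[OF assms comm_ring_hom_axioms])
  have "f \<in> mpolys UNIV" by simp
  then show ?thesis
    by (induction f rule: mpolys_induct)
      (simp_all add: dual_eval_add dual_eval_mult \<eta>'.dual_eval_add \<eta>'.dual_eval_mult
        \<eta>.hom_add \<eta>.hom_mult hom_mpoly_hom[OF assms comm_ring_hom_axioms])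
qed

text \<open>A chain rule: the linear coefficient depends only on the coefficients 0 and 1 of
  \<open>p\<close>, so \<open>p\<close> may be any polynomial curve through \<open>a\<close> with
  velocity \<open>v\<close>.\<close>

lemma dual_eval_of_coeffs:
  assumes "f \<in> mpolys J"
    and "\<And>i. i \<in> J \<Longrightarrow> Polynomial.coeff (p i) 0 = a i"
    and "\<And>i. i \<in> J \<Longrightarrow> Polynomial.coeff (p i) 1 = v i"
  shows "Polynomial.coeff (mpoly_hom (\<lambda>c. [:hom c:]) p f) 1 = dual_eval hom a v f"
  using assms(1)
proof (induction f rule: mpolys_induct)
  case (mult f g)
  have "mpoly_hom hom (\<lambda>i. Polynomial.coeff (p i) 0) h = mpoly_hom hom a h" if "h \<in> mpolys J" for h
    using that assms(2) by (rule mpoly_hom_cong)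
  with mult show ?case
    by (simp add: comm_ring_hom.mpoly_hom_mult[OF dual_eval_hom] coeff_mult_1 dual_eval_mult
        dual_eval_coeff_0 ac_simps del: One_nat_def)
qed (simp_all add: assms comm_ring_hom.mpoly_hom_mconst[OF dual_eval_hom]
    comm_ring_hom.mpoly_hom_mvar[OF dual_eval_hom] comm_ring_hom.mpoly_hom_add[OF dual_eval_hom]
    dual_eval_add coeff_pCons assms(3)[unfolded One_nat_def])

end

lemma dual_eval_cong:
  assumes "f \<in> mpolys J" "\<And>i. i \<in> J \<Longrightarrow> a i = b i" "\<And>i. i \<in> J \<Longrightarrow> v i = w i"
  shows "dual_eval \<kappa> a v f = dual_eval \<kappa> b w f"
  unfolding dual_eval_def
  by (rule arg_cong[of _ _ "\<lambda>p. Polynomial.coeff p 1"], rule mpoly_hom_cong[OF assms(1)])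
    (simp add: assms)

section \<open>Point derivations and Zariski tangent spaces\<close>

lemmas dual_eval_simps =
  comm_ring_hom.dual_eval_add[OF comm_ring_hom_ident]
  comm_ring_hom.dual_eval_mult[OF comm_ring_hom_ident, folded mpoly_eval_eq_hom]
  comm_ring_hom.dual_eval_mconst[OF comm_ring_hom_ident]
  comm_ring_hom.dual_eval_mvar[OF comm_ring_hom_ident]
  comm_ring_hom.dual_eval_diff[OF comm_ring_hom_ident]
  comm_ring_hom.dual_eval_sum[OF comm_ring_hom_ident]

text \<open>Since 1 is idempotent, \<open>D 1 = D 1 + D 1\<close>, so constants are killed.
  Additivity and the Leibniz rule then determine \<open>D\<close> from its values on the
  variables.\<close>

lemma zariski_tangent_eq_dual_eval:
  fixes a :: "'i \<Rightarrow> 'k::field"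
  assumes D: "D \<in> zariski_tangent J I a" and f: "f \<in> mpolys J"
  shows "D f = dual_eval (\<lambda>c. c) a (\<lambda>i. D (mvar i)) f"
proof -
  have 1: "(1::('i, 'k) mpoly) \<in> mpolys J" using mpolys_mconst[of 1 J] by simp
  have eval1: "mpoly_eval a 1 = 1"
    using mpoly_eval_simps(4)[of a 1] by simp
  have "D (1 * 1) = mpoly_eval a 1 * D 1 + mpoly_eval a 1 * D 1"
    using D 1 unfolding zariski_tangent_def by blast
  then have "D 1 = D 1 + D 1" by (simp only: eval1 mult_1)
  then have "D 1 = 0" by (metis add_cancel_right_right)
  have const: "D (mconst c) = 0" for c
  proof -
    have "D (mconst c * 1) = c * D 1" using D 1 unfolding zariski_tangent_def by blast
    then show ?thesis using \<open>D 1 = 0\<close> by simp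
  qed
  from f show ?thesis
  proof (induction f rule: mpolys_induct)
    case (add f g)
    moreover have "D (f + g) = D f + D g" using D add unfolding zariski_tangent_def by blast
    ultimately show ?case by (simp add: dual_eval_simps)
  next
    case (mult f g)
    moreover have "D (f * g) = mpoly_eval a f * D g + mpoly_eval a g * D f"
      using D mult unfolding zariski_tangent_def by blast
    ultimately show ?case by (simp add: dual_eval_simps)
  qed (simp_all add: const dual_eval_simps)
qed

text \<open>The value 0 off \<open>mpolys J\<close> matches the normalisation in
  \<open>zariski_tangent\<close>.\<close>

definition point_deriv :: "'i set \<Rightarrow> ('i \<Rightarrow> 'k::field) \<Rightarrow> ('i \<Rightarrow> 'k) \<Rightarrow> ('i, 'k) mpoly \<Rightarrow> 'k" where
  "point_deriv J a v f = (if f \<in> mpolys J then dual_eval (\<lambda>c. c) a v f else 0)"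

lemma point_deriv_in_tangent:
  fixes a :: "'i \<Rightarrow> 'k::field"
  assumes "\<And>f. f \<in> I \<Longrightarrow> point_deriv J a v f = 0"
  shows "point_deriv J a v \<in> zariski_tangent J I a"
proof -
  show ?thesis
    using assms unfolding zariski_tangent_def
    by (auto simp: point_deriv_def dual_eval_simps mpolys_add mpolys_mult mpolys_mconst
        mpoly_eval_simps)
qed

lemma point_deriv_mvar: "i \<in> J \<Longrightarrow> point_deriv J a v (mvar i) = v i"
  by (simp add: point_deriv_def mpolys_mvar dual_eval_simps)

lemma zariski_tangent_mono: "I \<subseteq> I' \<Longrightarrow> zariski_tangent J I' a \<subseteq> zariski_tangent J I a"
  by (auto simp: zariski_tangent_def)

lemma ideal_gen_superset: "F \<subseteq> ideal_gen J F"
proof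
  fix f assume "f \<in> F"
  then have "f = (\<Sum>f\<in>{f}. 1 * f)" "finite {f}" "{f} \<subseteq> F" "\<forall>f\<in>{f}. 1 \<in> mpolys J"
    using mpolys_mconst[of 1 J] by auto
  then show "f \<in> ideal_gen J F" unfolding ideal_gen_def
      by (intro CollectI exI[of _ "{f}"] exI[of _ "\<lambda>_. 1"]) auto
qed

text \<open>The Leibniz rule turns \<open>D (c * f)\<close> into a combination of \<open>D f\<close>
  and \<open>mpoly_eval a f\<close>, which both vanish for a generator \<open>f\<close>. Hence only
  generators have to be tested.\<close>

lemma zariski_tangent_ideal_gen:
  fixes a :: "'i \<Rightarrow> 'k::field"
  assumes F: "F \<subseteq> mpolys J" and a: "\<And>f. f \<in> F \<Longrightarrow> mpoly_eval a f = 0"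
  shows "zariski_tangent J (ideal_gen J F) a = zariski_tangent J F a"
proof
  show "zariski_tangent J (ideal_gen J F) a \<subseteq> zariski_tangent J F a"
    by (rule zariski_tangent_mono[OF ideal_gen_superset])
  show "zariski_tangent J F a \<subseteq> zariski_tangent J (ideal_gen J F) a"
  proof
    fix D assume D: "D \<in> zariski_tangent J F a"
    have mult: "D (c * f) = 0" if "c \<in> mpolys J" "f \<in> F" for c f
    proof -
      have "D (c * f) = mpoly_eval a c * D f + mpoly_eval a f * D c"
        using D that F unfolding zariski_tangent_def by blast
      moreover have "D f = 0" using D that unfolding zariski_tangent_def by blast
      ultimately show ?thesis using a that by simp
    qed
    have "D (\<Sum>f\<in>S. c f * f) = 0" if S: "finite S" "S \<subseteq> F" "\<forall>f\<in>S. c f \<in> mpolys J" for S c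
    proof -
      have "(\<Sum>f\<in>S. c f * f) \<in> mpolys J \<and> D (\<Sum>f\<in>S. c f * f) = 0"
        using S
      proof (induction S rule: finite_induct)
        case empty
        have "D (mconst 0) = 0" using zariski_tangent_eq_dual_eval[OF D mpolys_mconst]
          by (simp only: dual_eval_simps)
        then show ?case using mpolys_mconst[of 0 J] by simp
      next
        case (insert f S)
        then have *: "c f * f \<in> mpolys J" using F by (auto intro: mpolys_mult)
        with insert have "D (c f * f + (\<Sum>f\<in>S. c f * f)) = D (c f * f) + D (\<Sum>f\<in>S. c f * f)"
          using D unfolding zariski_tangent_def by blast
        with insert * mult show ?case by (auto intro: mpolys_add)
      qed
      then show ?thesis ..
    qed
    then have "\<forall>f\<in>ideal_gen J F. D f = 0" unfolding ideal_gen_def by blast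
    with D show "D \<in> zariski_tangent J (ideal_gen J F) a" by (simp add: zariski_tangent_def)
  qed
qed

text \<open>The extension of derivations requires characteristic 0 and is applied to the fraction
  field of a polynomial ring.\<close>

instance fract :: ("{idom,ring_char_0}") field_char_0
proof
  show "inj (of_nat :: nat \<Rightarrow> 'a fract)"
    by (rule injI) (simp add: of_nat_fract eq_fract)
qed

section \<open>Extension of derivations\<close>

text \<open>A derivation from a subring of a field into the field is encoded as its graph, a subring of
  the dual numbers over the field.\<close>

definition dual_subring :: "('a::comm_ring_1 \<times> 'a) set \<Rightarrow> bool" where
  "dual_subring G \<longleftrightarrow> (1, 0) \<in> G \<and>
     (\<forall>a a' b b'. (a, a') \<in> G \<longrightarrow> (b, b') \<in> G \<longrightarrow>
        (a - b, a' - b') \<in> G \<and> (a * b, a * b' + b * a') \<in> G)"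

text \<open>By closure under differences, single-valuedness reduces to the condition over 0.\<close>

definition deriv_graph :: "('a::comm_ring_1 \<times> 'a) set \<Rightarrow> bool" where
  "deriv_graph G \<longleftrightarrow> dual_subring G \<and> (\<forall>c. (0, c) \<in> G \<longrightarrow> c = 0)"

context
  fixes G :: "('a::comm_ring_1 \<times> 'a) set"
  assumes G: "dual_subring G"
begin

lemma dual_subring_1: "(1, 0) \<in> G"
  using G by (simp add: dual_subring_def)

lemma dual_subring_diff: "(a, a') \<in> G \<Longrightarrow> (b, b') \<in> G \<Longrightarrow> (a - b, a' - b') \<in> G"
  using G by (simp add: dual_subring_def)

lemma dual_subring_mult: "(a, a') \<in> G \<Longrightarrow> (b, b') \<in> G \<Longrightarrow> (a * b, a * b' + b * a') \<in> G"
  using G by (simp add: dual_subring_def)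

lemma dual_subring_0: "(0, 0) \<in> G"
  using dual_subring_diff[OF dual_subring_1 dual_subring_1] by simp

lemma dual_subring_add:
  assumes "(a, a') \<in> G" "(b, b') \<in> G"
  shows "(a + b, a' + b') \<in> G"
  using dual_subring_diff[OF assms(1) dual_subring_diff[OF dual_subring_0 assms(2)]] by simp

lemma dual_subring_sum:
  "(\<And>i. i \<in> A \<Longrightarrow> (f i, f' i) \<in> G) \<Longrightarrow> (sum f A, sum f' A) \<in> G"
  by (induction A rule: infinite_finite_induct) (auto intro: dual_subring_0 dual_subring_add)

lemma dual_subring_of_nat_mult: "(a, a') \<in> G \<Longrightarrow> (of_nat k * a, of_nat k * a') \<in> G"
  by (induction k) (auto intro: dual_subring_0 dual_subring_add simp: distrib_right)

end

text \<open>For a graph \<open>G\<close> of a derivation, \<open>p'\<close> is \<open>p\<close> with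
  its coefficients differentiated.\<close>

definition dual_polys :: "('a::comm_ring_1 \<times> 'a) set \<Rightarrow> ('a poly \<times> 'a poly) set" where
  "dual_polys G = {(p, p'). \<forall>i. (Polynomial.coeff p i, Polynomial.coeff p' i) \<in> G}"

text \<open>By the chain rule, this is the value at \<open>poly p z\<close> forced on an extension
  that sends \<open>z\<close> to \<open>w\<close>.\<close>

definition deriv_at :: "'a::field \<Rightarrow> 'a \<Rightarrow> 'a poly \<Rightarrow> 'a poly \<Rightarrow> 'a" where
  "deriv_at z w p p' = poly p' z + poly (pderiv p) z * w"

lemma deriv_at_diff: "deriv_at z w (p - q) (p' - q') = deriv_at z w p p' - deriv_at z w q q'"
  by (simp add: deriv_at_def pderiv_diff algebra_simps)

lemma deriv_at_mult:
  "deriv_at z w (p * q) (p * q' + q * p') = poly p z * deriv_at z w q q'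
      + poly q z * deriv_at z w p p'"
  by (simp add: deriv_at_def pderiv_mult algebra_simps)

lemma dual_subring_dual_polys:
  assumes G: "dual_subring G"
  shows "dual_subring (dual_polys G)"
  unfolding dual_subring_def
proof (intro conjI allI impI)
  show "(1, 0) \<in> dual_polys G"
    by (auto simp: dual_polys_def coeff_1 dual_subring_0[OF G] dual_subring_1[OF G])
  fix p p' q q' assume pq: "(p, p') \<in> dual_polys G" "(q, q') \<in> dual_polys G"
  then show "(p - q, p' - q') \<in> dual_polys G"
    by (auto simp: dual_polys_def intro: dual_subring_diff[OF G])
  have "(Polynomial.coeff (p * q) i, Polynomial.coeff (p * q' + q * p') i) \<in> G" for i
  proof -
    have "Polynomial.coeff (p * q' + p' * q) i =
      (\<Sum>j\<le>i. Polynomial.coeff p j * Polynomial.coeff q' (i - j)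
        + Polynomial.coeff q (i - j) * Polynomial.coeff p' j)"
      by (simp add: coeff_mult sum.distrib ac_simps)
    then show ?thesis unfolding mult.commute[of q p']
      by (auto simp: coeff_mult[of p q] intro!: dual_subring_sum[OF G] dual_subring_mult[OF G])
        (use pq in \<open>auto simp: dual_polys_def\<close>)
  qed
  then show "(p * q, p * q' + q * p') \<in> dual_polys G" by (simp add: dual_polys_def)
qed

text \<open>The image is the candidate graph over the ring generated by \<open>z\<close>. Only its
  single-valuedness depends on a good choice of \<open>w\<close>.\<close>

lemma dual_subring_adjoin:
  assumes G: "dual_subring G"
  shows "dual_subring ((\<lambda>(p, p'). (poly p z, deriv_at z w p p')) ` dual_polys G)"
    (is "dual_subring ?G'")
  unfolding dual_subring_def
proof (intro conjI allI impI)
  note GX = dual_subring_dual_polys[OF G]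
  have I: "(poly p z, deriv_at z w p p') \<in> ?G'" if "(p, p') \<in> dual_polys G" for p p'
    using that by force
  show "(1, 0) \<in> ?G'" using I[OF dual_subring_1[OF GX]] by (simp add: deriv_at_def)
  fix a a' b b' assume "(a, a') \<in> ?G'" "(b, b') \<in> ?G'"
  then obtain p p' q q' where pq: "(p, p') \<in> dual_polys G" "(q, q') \<in> dual_polys G"
    "a = poly p z" "a' = deriv_at z w p p'" "b = poly q z" "b' = deriv_at z w q q'" by auto
  then show "(a - b, a' - b') \<in> ?G'" "(a * b, a * b' + b * a') \<in> ?G'"
    using I[OF dual_subring_diff[OF GX pq(1,2)]] I[OF dual_subring_mult[OF GX pq(1,2)]]
    by (simp_all add: deriv_at_diff deriv_at_mult)
qed

text \<open>If \<open>z\<close> is algebraic, the derivative \<open>w\<close> of \<open>z\<close> is forced by a polynomial of minimal degree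
  vanishing at \<open>z\<close>; otherwise it is arbitrary.\<close>

lemma deriv_graph_adjoin:
  fixes G :: "('a::field_char_0 \<times> 'a) set"
  assumes G: "deriv_graph G"
  shows "\<exists>w. \<forall>(p, p')\<in>dual_polys G. poly p z = 0 \<longrightarrow> deriv_at z w p p' = 0"
proof -
  have sub: "dual_subring G" and G0: "\<And>c. (0, c) \<in> G \<Longrightarrow> c = 0"
    using G by (auto simp: deriv_graph_def)
  note GX = dual_subring_dual_polys[OF sub]
  have p0: "p' = 0" if "(0, p') \<in> dual_polys G" for p'
    using that G0 by (auto simp: dual_polys_def poly_eq_iff)
  let ?Z = "{(p, p') \<in> dual_polys G. p \<noteq> 0 \<and> poly p z = 0}"
  show ?thesis
  proof (cases "?Z = {}")
    case True
    \<comment> \<open>Only the zero polynomial vanishes at \<open>z\<close>, so any \<open>w\<close>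
      works and 0 is taken.\<close>
    then have "\<forall>(p, p')\<in>dual_polys G. poly p z = 0 \<longrightarrow> deriv_at z 0 p p' = 0"
      using p0 by (fastforce simp: deriv_at_def)
    then show ?thesis ..
  next
    case False
    then obtain M where M: "M \<in> ?Z" "\<And>N. N \<in> ?Z \<Longrightarrow> degree (fst M) \<le> degree (fst N)"
      using ex_has_least_nat[of "\<lambda>N. N \<in> ?Z" _ "\<lambda>N. degree (fst N)"] by blast
    obtain m m' where mm: "M = (m, m')" by (cases M)
    have m: "(m, m') \<in> dual_polys G" "m \<noteq> 0" "poly m z = 0" using M mm by auto
    have min: "degree m \<le> degree p" if "(p, p') \<in> dual_polys G" "p \<noteq> 0" "poly p z = 0" for p p'
      using M(2)[of "(p, p')"] that mm by auto
    have deg: "degree m > 0"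
      using m by (metis degree_eq_zeroE neq0_conv poly_pCons poly_0 mult_zero_right
          add.right_neutral pCons_0_0)
    \<comment> \<open>The formal derivative of \<open>m\<close> is nonzero in characteristic 0 and
      of smaller degree, so by minimality it does not vanish at \<open>z\<close>. This allows the
      division in \<open>w\<close>.\<close>
    have "(pderiv m, pderiv m') \<in> dual_polys G"
      using m(1) dual_subring_of_nat_mult[OF sub] unfolding dual_polys_def
          by (auto simp: coeff_pderiv simp del: of_nat_Suc)
    moreover have "pderiv m \<noteq> 0" "degree (pderiv m) < degree m"
      using deg by (auto simp: pderiv_eq_0_iff degree_pderiv)
    ultimately have dz: "poly (pderiv m) z \<noteq> 0" using min by fastforce
    define w where "w = - poly m' z / poly (pderiv m) z"
    have wm: "deriv_at z w m m' = 0" using dz by (simp add: deriv_at_def w_def)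
    have "deriv_at z w p p' = 0" if "(p, p') \<in> dual_polys G" "poly p z = 0" for p p'
      using that
    proof (induction "degree p" arbitrary: p p' rule: less_induct)
      case less
      show ?case
      proof (cases "p = 0")
        case True
        then show ?thesis using p0[of p'] less.prems by (simp add: deriv_at_def)
      next
        case False
        let ?k = "degree p - degree m"
        let ?c = "[:lead_coeff m:]" and ?c' = "[:Polynomial.coeff m' (degree m):]"
        let ?q = "Polynomial.monom (lead_coeff p) ?k" and ?q'
            = "Polynomial.monom (Polynomial.coeff p' (degree p)) ?k"
        have le: "degree m \<le> degree p" using min less False by blast
        have c: "(?c, ?c') \<in> dual_polys G"
          using m(1) dual_subring_0[OF sub] by (auto simp: dual_polys_def coeff_pCons split:
              nat.split)
        have q: "(?q, ?q') \<in> dual_polys G"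
          using less.prems dual_subring_0[OF sub] by (auto simp: dual_polys_def)
        \<comment> \<open>Pseudo-division: the domain of \<open>G\<close> is only a ring, so
          \<open>p\<close> is multiplied by the leading coefficient of \<open>m\<close> before the
          leading terms are cancelled. \<open>?r'\<close> is what the product rule
          prescribes.\<close>
        let ?r = "?c * p - ?q * m" and ?r' = "(?c * p' + p * ?c') - (?q * m' + m * ?q')"
        have r: "(?r, ?r') \<in> dual_polys G"
          by (intro dual_subring_diff[OF GX] dual_subring_mult[OF GX] c q m less.prems)
        have rz: "poly ?r z = 0" using m less by simp
        have "deriv_at z w ?r ?r' = 0"
        proof (cases "?r = 0")
          case True
          have "?r' = 0" by (rule p0) (use r in \<open>unfold True\<close>)
          then show ?thesis unfolding True by (simp only: deriv_at_def pderiv_0 poly_0) simp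
        next
          case False
          have "degree ?r < degree p"
          proof (rule degree_lessI)
            show "?r \<noteq> 0 \<or> degree p > 0" using False by simp
            show "\<forall>k\<ge>degree p. Polynomial.coeff ?r k = 0"
            proof (intro allI impI)
              fix k assume k: "k \<ge> degree p"
              show "Polynomial.coeff ?r k = 0"
              proof (cases "k = degree p")
                case True
                then show ?thesis using le by (simp add: coeff_monom_mult)
              next
                case False
                then show ?thesis using le k by (simp add: coeff_monom_mult coeff_eq_0)
              qed
            qed
          qed
          from less.hyps[OF this r rz] show ?thesis .
        qed
        \<comment> \<open>All other terms vanish because \<open>p\<close> and \<open>m\<close>
          vanish at \<open>z\<close> and \<open>wm\<close> holds; the remaining factor
          \<open>lead_coeff m\<close> is nonzero and cancels.\<close>
        moreover have "deriv_at z w ?r ?r' = lead_coeff m * deriv_at z w p p'"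
          unfolding deriv_at_diff deriv_at_mult using wm m less.prems by simp
        ultimately show ?thesis using m by simp
      qed
    qed
    then show ?thesis by blast
  qed
qed

text \<open>Zorn's lemma yields a maximal graph containing \<open>G\<close>. Any \<open>z\<close>
  can be adjoined to it by \<open>deriv_graph_adjoin\<close>, so maximality makes it defined
  everywhere.\<close>

theorem derivation_extension:
  fixes G :: "('a::field_char_0 \<times> 'a) set"
  assumes G: "deriv_graph G"
  obtains \<Delta> where "\<And>a b. \<Delta> (a + b) = \<Delta> a + \<Delta> b" "\<And>a b. \<Delta> (a * b) = a * \<Delta> b + b * \<Delta> a"
    "\<And>a a'. (a, a') \<in> G \<Longrightarrow> \<Delta> a = a'"
proof -
  let ?A = "{H. G \<subseteq> H \<and> deriv_graph H}"
  have "\<exists>M\<in>?A. \<forall>X\<in>?A. M \<subseteq> X \<longrightarrow> X = M"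
  proof (rule subset_Zorn_nonempty)
    show "?A \<noteq> {}" using G by blast
    fix C assume C: "C \<noteq> {}" "subset.chain ?A C"
    then obtain X0 where X0: "X0 \<in> C" by blast
    have CA: "X \<in> C \<Longrightarrow> G \<subseteq> X \<and> deriv_graph X" for X
      using C(2) by (auto simp: subset.chain_def)
    have common: "\<exists>X\<in>C. a \<in> X \<and> b \<in> X" if ab: "a \<in> \<Union>C" "b \<in> \<Union>C" for a b
    proof -
      from ab obtain X Y where XY: "X \<in> C" "Y \<in> C" "a \<in> X" "b \<in> Y" by blast
      then have "X \<subseteq> Y \<or> Y \<subseteq> X" using C(2) by (auto simp: subset_chain_def)
      with XY show ?thesis by blast
    qed
    have "dual_subring (\<Union>C)"
      unfolding dual_subring_def
    proof (intro conjI allI impI)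
      show "(1, 0) \<in> \<Union>C" using X0 CA[OF X0] by (auto simp: deriv_graph_def dual_subring_def)
      fix a a' b b' assume "(a, a') \<in> \<Union>C" "(b, b') \<in> \<Union>C"
      from common[OF this] obtain X where X: "X \<in> C" "(a, a') \<in> X" "(b, b') \<in> X" by blast
      then have "dual_subring X" using CA by (auto simp: deriv_graph_def)
      from dual_subring_diff[OF this X(2,3)] dual_subring_mult[OF this X(2,3)]
      show "(a - b, a' - b') \<in> \<Union>C" "(a * b, a * b' + b * a') \<in> \<Union>C"
        using X(1) by blast+
    qed
    moreover have "\<forall>c. (0, c) \<in> \<Union>C \<longrightarrow> c = 0" using CA by (auto simp: deriv_graph_def)
    ultimately show "\<Union>C \<in> ?A" using X0 CA[OF X0] by (auto simp: deriv_graph_def)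
  qed
  then obtain M where MA: "M \<in> ?A" and max: "\<forall>X\<in>?A. M \<subseteq> X \<longrightarrow> X = M" by (rule bexE)
  from MA have GM: "G \<subseteq> M" and M: "deriv_graph M" by simp_all
  have sub: "dual_subring M" and M0: "\<And>c. (0, c) \<in> M \<Longrightarrow> c = 0"
    using M by (auto simp: deriv_graph_def)
  have ex: "\<exists>w. (z, w) \<in> M" for z
  proof -
    obtain w where w: "\<forall>(p, p')\<in>dual_polys M. poly p z = 0 \<longrightarrow> deriv_at z w p p' = 0"
      using deriv_graph_adjoin[OF M] by blast
    let ?M' = "(\<lambda>(p, p'). (poly p z, deriv_at z w p p')) ` dual_polys M"
    have "deriv_graph ?M'"
      unfolding deriv_graph_def using dual_subring_adjoin[OF sub] w by fastforce
    moreover have "M \<subseteq> ?M'"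
    proof clarify
      fix a b assume "(a, b) \<in> M"
      then have "([:a:], [:b:]) \<in> dual_polys M"
        using dual_subring_0[OF sub] by (auto simp: dual_polys_def coeff_pCons split: nat.split)
      then show "(a, b) \<in> ?M'" by (force simp: deriv_at_def)
    qed
    ultimately have "?M' = M" using max GM by simp
    \<comment> \<open>The polynomial variable, paired with 0, evaluates to \<open>z\<close> and
      receives the derivative \<open>w\<close>.\<close>
    moreover have "(Polynomial.monom 1 1, 0) \<in> dual_polys M"
      using dual_subring_0[OF sub] dual_subring_1[OF sub] by (auto simp: dual_polys_def)
    then have "(z, w) \<in> ?M'"
      by (force simp: deriv_at_def poly_monom pderiv_monom)
    ultimately show ?thesis by blast
  qed
  have uniq: "b = c" if "(a, b) \<in> M" "(a, c) \<in> M" for a b c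
    using dual_subring_diff[OF sub that] M0[of "b - c"] by simp
  define \<Delta> where "\<Delta> z = (SOME w. (z, w) \<in> M)" for z
  have \<Delta>M: "(z, \<Delta> z) \<in> M" for z unfolding \<Delta>_def by (rule someI_ex[OF ex])
  show ?thesis
  proof
    show "\<Delta> (a + b) = \<Delta> a + \<Delta> b" for a b
      by (rule uniq[OF \<Delta>M dual_subring_add[OF sub \<Delta>M \<Delta>M]])
    show "\<Delta> (a * b) = a * \<Delta> b + b * \<Delta> a" for a b
      by (rule uniq[OF \<Delta>M dual_subring_mult[OF sub \<Delta>M \<Delta>M]])
    show "\<Delta> a = a'" if "(a, a') \<in> G" for a a'
      using uniq[OF \<Delta>M] GM that by blast
  qed
qed

section \<open>Transport of structure constants\<close>

text \<open>If \<open>p\<close> is the inverse matrix of \<open>h\<close>, then \<open>tensor_act n p h x\<close> are the structure constants of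
  the product \<open>h\<^sup>-\<^sup>1 \<cdot> x\<close>, and \<open>tensor_dact n M x\<close> is the derivative of \<open>t \<mapsto> (1 + t M)\<^sup>-\<^sup>1 \<cdot> x\<close> at 0.\<close>

definition tensor_act ::
  "nat \<Rightarrow> (nat \<Rightarrow> nat \<Rightarrow> 'a::comm_ring_1) \<Rightarrow> (nat \<Rightarrow> nat \<Rightarrow> 'a) \<Rightarrow> (sc_index \<Rightarrow> 'a) \<Rightarrow> sc_index \<Rightarrow> 'a" where
  "tensor_act n p h x =
     (\<lambda>(i, j, l). \<Sum>c<n. p l c * (\<Sum>a<n. h a i * (\<Sum>b<n. h b j * x (a, b, c))))"

definition tensor_dact ::
  "nat \<Rightarrow> (nat \<Rightarrow> nat \<Rightarrow> 'a::comm_ring_1) \<Rightarrow> (sc_index \<Rightarrow> 'a) \<Rightarrow> sc_index \<Rightarrow> 'a" where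
  "tensor_dact n M x =
     (\<lambda>(i, j, l). (\<Sum>a<n. M a i * x (a, j, l)) + (\<Sum>b<n. M b j * x (i, b, l))
        - (\<Sum>c<n. M l c * x (i, j, c)))"

text \<open>Allowing a scalar \<open>q\<close> avoids division, so that a matrix and its adjugate
  over a polynomial ring fit, with \<open>q\<close> the determinant.\<close>

definition scaled_inverse ::
  "nat \<Rightarrow> (nat \<Rightarrow> nat \<Rightarrow> 'a::comm_ring_1) \<Rightarrow> (nat \<Rightarrow> nat \<Rightarrow> 'a) \<Rightarrow> 'a \<Rightarrow> bool" where
  "scaled_inverse n p h q \<longleftrightarrow> (\<forall>i<n. \<forall>j<n.
     (\<Sum>c<n. p i c * h c j) = (if i = j then q else 0) \<and>
     (\<Sum>c<n. h i c * p c j) = (if i = j then q else 0))"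

lemma hom_tensor_act:
  assumes "comm_ring_hom \<eta>"
  shows "\<eta> (tensor_act n p h x t) =
    tensor_act n (\<lambda>i j. \<eta> (p i j)) (\<lambda>i j. \<eta> (h i j)) (\<lambda>t. \<eta> (x t)) t"
proof -
  interpret \<eta>: comm_ring_hom \<eta> by fact
  show ?thesis
    unfolding tensor_act_def
    by (cases t) (simp only: prod.case \<eta>.hom_sum \<eta>.hom_mult)
qed

lemma hom_scaled_inverse:
  assumes "comm_ring_hom \<eta>" "scaled_inverse n p h q"
  shows "scaled_inverse n (\<lambda>i j. \<eta> (p i j)) (\<lambda>i j. \<eta> (h i j)) (\<eta> q)"
proof -
  interpret \<eta>: comm_ring_hom \<eta> by fact
  have "(\<Sum>c<n. \<eta> (p i c) * \<eta> (h c j)) = \<eta> (\<Sum>c<n. p i c * h c j)"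
    "(\<Sum>c<n. \<eta> (h i c) * \<eta> (p c j)) = \<eta> (\<Sum>c<n. h i c * p c j)" for i j
    by (simp_all only: \<eta>.hom_sum \<eta>.hom_mult)
  then show ?thesis using assms(2) unfolding scaled_inverse_def by simp
qed

lemma sum_delta_mult:
  fixes q :: "'a::comm_ring_1" and i n :: nat
  shows "i < n \<Longrightarrow> (\<Sum>a<n. (if a = i then q else 0) * f a) = q * f i"
    and "i < n \<Longrightarrow> (\<Sum>a<n. (if i = a then q else 0) * f a) = q * f i"
proof -
  have "(\<Sum>a<n. (if a = i then q else 0) * f a) = (\<Sum>a<n. if a = i then q * f a else 0)"
    by (rule sum.cong) auto
  then show "(\<Sum>a<n. (if a = i then q else 0) * f a) = q * f i" if "i < n" using that
      by (simp add: sum.delta)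
  then show "(\<Sum>a<n. (if i = a then q else 0) * f a) = q * f i" if "i < n"
    using that by (simp only: eq_commute[of i])
qed

section \<open>Cancelling inverse matrices in contractions\<close>

lemma sum_contract:
  fixes p :: "nat \<Rightarrow> 'a::comm_ring_1" and n :: nat
  shows "(\<Sum>i<n. p i * (\<Sum>a<n. g a i * f a)) = (\<Sum>a<n. (\<Sum>i<n. g a i * p i) * f a)"
  unfolding sum_distrib_left sum_distrib_right
  by (subst sum.swap) (simp add: ac_simps)

lemma sum_contract':
  fixes g :: "nat \<Rightarrow> 'a::comm_ring_1" and n :: nat
  shows "(\<Sum>l<n. g l * (\<Sum>d<n. p l d * f d)) = (\<Sum>d<n. (\<Sum>l<n. g l * p l d) * f d)"
  unfolding sum_distrib_left sum_distrib_right
  by (subst sum.swap) (simp add: ac_simps)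

text \<open>Contracting the output index with \<open>h\<close> cancels \<open>p\<close>. The
  resulting identity can be differentiated without differentiating \<open>p\<close>.\<close>

lemma tensor_act_contract_upper:
  assumes "scaled_inverse n p h 1" "c < n"
  shows "(\<Sum>l<n. h c l * tensor_act n p h x (i, j, l)) = (\<Sum>a<n. h a i * (\<Sum>b<n. h b j * x (a, b, c)))"
proof -
  have "(\<Sum>l<n. h c l * tensor_act n p h x (i, j, l))
      = (\<Sum>d<n. (if c = d then 1 else 0) * (\<Sum>a<n. h a i * (\<Sum>b<n. h b j * x (a, b, d))))"
    unfolding tensor_act_def prod.case sum_contract'
    using assms by (intro sum.cong) (auto simp: scaled_inverse_def)
  then show ?thesis using assms(2) by (simp only: sum_delta_mult mult_1)
qed

lemma contract_lower:
  fixes p :: "nat \<Rightarrow> nat \<Rightarrow> 'a::comm_ring_1"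
  shows "(\<Sum>i<n. p i i' * (\<Sum>j<n. p j j' * (\<Sum>a<n. g a i * (\<Sum>b<n. k b j * X a b))))
    = (\<Sum>a<n. (\<Sum>i<n. g a i * p i i') * (\<Sum>b<n. (\<Sum>j<n. k b j * p j j') * X a b))"
proof -
  have "(\<Sum>j<n. p j j' * (\<Sum>a<n. g a i * (\<Sum>b<n. k b j * X a b)))
      = (\<Sum>a<n. g a i * (\<Sum>b<n. (\<Sum>j<n. k b j * p j j') * X a b))" for i
  proof -
    have "(\<Sum>j<n. p j j' * (\<Sum>a<n. g a i * (\<Sum>b<n. k b j * X a b)))
        = (\<Sum>a<n. g a i * (\<Sum>j<n. p j j' * (\<Sum>b<n. k b j * X a b)))"
      unfolding sum_distrib_left[of _ _ "{..<n}"]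
      by (subst sum.swap) (simp add: ac_simps sum_distrib_left)
    then show ?thesis unfolding sum_contract .
  qed
  then show ?thesis by (simp only: sum_contract)
qed

text \<open>Contraction with \<open>p\<close> undoes the transport of the input indices. The three
  forms cover the terms of the product rule: no input factor differentiated, the first, or the
  second, with \<open>g\<close> as the differentiated matrix.\<close>

lemma contract_lower_inverse:
  assumes "scaled_inverse n p h 1" "i' < n" "j' < n"
  shows "(\<Sum>i<n. p i i' * (\<Sum>j<n. p j j' * (\<Sum>a<n. h a i * (\<Sum>b<n. h b j * X a b)))) = X i' j'"
    and "(\<Sum>i<n. p i i' * (\<Sum>j<n. p j j' * (\<Sum>a<n. g a i * (\<Sum>b<n. h b j * X a b))))
      = (\<Sum>a<n. (\<Sum>i<n. g a i * p i i') * X a j')"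
    and "(\<Sum>i<n. p i i' * (\<Sum>j<n. p j j' * (\<Sum>a<n. h a i * (\<Sum>b<n. g b j * X a b))))
      = (\<Sum>b<n. (\<Sum>j<n. g b j * p j j') * X i' b)"
proof -
  have d: "(\<Sum>b<n. (\<Sum>j<n. h b j * p j k) * f b) = f k" if "k < n" for k and f :: "nat \<Rightarrow> 'a"
  proof -
    have "(\<Sum>b<n. (\<Sum>j<n. h b j * p j k) * f b) = (\<Sum>b<n. (if b = k then 1 else 0) * f b)"
      using assms(1) that by (intro sum.cong) (auto simp: scaled_inverse_def)
    then show ?thesis using that by (simp only: sum_delta_mult mult_1)
  qed
  show "(\<Sum>i<n. p i i' * (\<Sum>j<n. p j j' * (\<Sum>a<n. h a i * (\<Sum>b<n. h b j * X a b)))) = X i' j'"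
    "(\<Sum>i<n. p i i' * (\<Sum>j<n. p j j' * (\<Sum>a<n. g a i * (\<Sum>b<n. h b j * X a b))))
      = (\<Sum>a<n. (\<Sum>i<n. g a i * p i i') * X a j')"
    "(\<Sum>i<n. p i i' * (\<Sum>j<n. p j j' * (\<Sum>a<n. h a i * (\<Sum>b<n. g b j * X a b))))
      = (\<Sum>b<n. (\<Sum>j<n. g b j * p j j') * X i' b)"
    unfolding contract_lower by (simp_all only: d assms)
qed

section \<open>Differentiating transported structure constants\<close>

locale derivation =
  fixes \<Delta> :: "'a::field \<Rightarrow> 'a"
  assumes add: "\<Delta> (a + b) = \<Delta> a + \<Delta> b"
    and mult: "\<Delta> (a * b) = a * \<Delta> b + b * \<Delta> a"
begin

lemma zero [simp]: "\<Delta> 0 = 0"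
  using add[of 0 0] by (metis add_cancel_right_right add_0_right)

lemma sum: "\<Delta> (sum f A) = (\<Sum>i\<in>A. \<Delta> (f i))"
  by (induction A rule: infinite_finite_induct) (auto simp: add)

text \<open>Differentiate the identity of \<open>tensor_act_contract_upper\<close>, treating
  \<open>x\<close> as constant, and pull the input indices back along \<open>p\<close>. The matrix
  that appears is the logarithmic derivative of \<open>h\<close>.\<close>

lemma tensor_dact_of_transport_inverse:
  assumes inv: "scaled_inverse n p h 1"
    and x: "\<And>t. t \<in> sc_indices n \<Longrightarrow> \<Delta> (x t) = 0"
    and W: "\<And>t. t \<in> sc_indices n \<Longrightarrow> \<Delta> (tensor_act n p h x t) = tensor_act n p h v t"
    and t: "t \<in> sc_indices n"
  shows "v t = tensor_dact n (\<lambda>a i. \<Sum>k<n. \<Delta> (h a k) * p k i) x t"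
proof -
  obtain i' j' c where t_eq: "t = (i', j', c)" by (cases t)
  with t have lt: "i' < n" "j' < n" "c < n" by (auto simp: sc_indices_def)
  let ?M = "\<lambda>a i. \<Sum>k<n. \<Delta> (h a k) * p k i"
  let ?C = "\<lambda>F. \<Sum>i<n. p i i' * (\<Sum>j<n. p j j' * F i j)"
  let ?Y = "tensor_act n p h x" and ?W = "tensor_act n p h v"
  have C_add: "?C (\<lambda>i j. F i j + G i j) = ?C F + ?C G" for F G
    by (simp add: distrib_left sum.distrib)
  have eq: "(\<Sum>l<n. h c l * ?W (i, j, l)) + (\<Sum>l<n. \<Delta> (h c l) * ?Y (i, j, l)) =
     (\<Sum>a<n. h a i * (\<Sum>b<n. \<Delta> (h b j) * x (a, b, c))) + (\<Sum>a<n. \<Delta> (h a i) * (\<Sum>b<n. h b j * x (a, b,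
         c)))"
    if "i < n" "j < n" for i j
  proof -
    have "\<Delta> (\<Sum>l<n. h c l * ?Y (i, j, l)) = (\<Sum>l<n. h c l * ?W (i, j, l))
        + (\<Sum>l<n. \<Delta> (h c l) * ?Y (i, j, l))"
      using W that by (auto simp: sum mult sc_indices_def sum.distrib[symmetric] ac_simps intro!:
          sum.cong)
    moreover have "\<Delta> (\<Sum>a<n. h a i * (\<Sum>b<n. h b j * x (a, b, c))) =
      (\<Sum>a<n. h a i * (\<Sum>b<n. \<Delta> (h b j) * x (a, b, c)) + \<Delta> (h a i) * (\<Sum>b<n. h b j * x (a, b, c)))"
      unfolding sum mult
    proof (intro sum.cong refl, goal_cases)
      case (1 a)
      then have "\<Delta> (x (a, b, c)) = 0" if "b < n" for b
        using x lt that by (auto simp: sc_indices_def)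
      then show ?case by (simp add: ac_simps)
    qed
    ultimately show ?thesis
      unfolding tensor_act_contract_upper[OF inv lt(3)] by (simp only: sum.distrib)
  qed
  have "?C (\<lambda>i j. (\<Sum>l<n. h c l * ?W (i, j, l)) + (\<Sum>l<n. \<Delta> (h c l) * ?Y (i, j, l))) =
     ?C (\<lambda>i j. (\<Sum>a<n. h a i * (\<Sum>b<n. \<Delta> (h b j) * x (a, b, c))) + (\<Sum>a<n. \<Delta> (h a i) * (\<Sum>b<n. h b j *
         x (a, b, c))))"
    using eq by (intro sum.cong arg_cong2[of _ _ _ _ "(*)"] refl) auto
  then have main: "?C (\<lambda>i j. \<Sum>l<n. h c l * ?W (i, j, l)) + ?C (\<lambda>i j. \<Sum>l<n. \<Delta> (h c l) * ?Y (i, j,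
      l)) =
      ?C (\<lambda>i j. \<Sum>a<n. h a i * (\<Sum>b<n. \<Delta> (h b j) * x (a, b, c)))
      + ?C (\<lambda>i j. \<Sum>a<n. \<Delta> (h a i) * (\<Sum>b<n. h b j * x (a, b, c)))"
    by (simp only: C_add)
  have 1: "?C (\<lambda>i j. \<Sum>l<n. h c l * ?W (i, j, l)) = v t"
    unfolding tensor_act_contract_upper[OF inv lt(3)] contract_lower_inverse[OF inv lt(1,2)] t_eq ..
  \<comment> \<open>The factor \<open>p\<close> inside \<open>?Y\<close> combines with the
    derivative of \<open>h\<close> to form \<open>?M\<close>.\<close>
  have "(\<Sum>l<n. \<Delta> (h c l) * ?Y (i, j, l)) =
      (\<Sum>a<n. h a i * (\<Sum>b<n. h b j * (\<Sum>d<n. ?M c d * x (a, b, d))))" for i j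
  proof -
    have "(\<Sum>l<n. \<Delta> (h c l) * ?Y (i, j, l)) =
        (\<Sum>d<n. ?M c d * (\<Sum>a<n. h a i * (\<Sum>b<n. h b j * x (a, b, d))))"
      unfolding tensor_act_def prod.case sum_contract' ..
    also have "\<dots> = (\<Sum>a<n. \<Sum>d<n. \<Sum>b<n. ?M c d * (h a i * (h b j * x (a, b, d))))"
      unfolding sum_distrib_left by (subst sum.swap) simp
    also have "\<dots> = (\<Sum>a<n. \<Sum>b<n. \<Sum>d<n. ?M c d * (h a i * (h b j * x (a, b, d))))"
      by (rule sum.cong[OF refl], rule sum.swap)
    also have "\<dots> = (\<Sum>a<n. h a i * (\<Sum>b<n. h b j * (\<Sum>d<n. ?M c d * x (a, b, d))))"
      unfolding sum_distrib_left[of "h _ _"] by (simp add: ac_simps)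
    finally show ?thesis .
  qed
  then have 2: "?C (\<lambda>i j. \<Sum>l<n. \<Delta> (h c l) * ?Y (i, j, l)) = (\<Sum>d<n. ?M c d * x (i', j', d))"
    by (simp only: contract_lower_inverse[OF inv lt(1,2)])
  from main show ?thesis
    unfolding 1 2 contract_lower_inverse[OF inv lt(1,2)]
    by (simp add: tensor_dact_def t_eq algebra_simps)
qed

text \<open>Dividing \<open>p\<close> by \<open>q\<close> reduces to a true inverse. The derivative
  of \<open>q\<close> leaves a multiple of \<open>x\<close>, which is absorbed into the
  matrix.\<close>

lemma tensor_dact_of_transport:
  assumes inv: "scaled_inverse n p h q" and q: "q \<noteq> 0"
    and x: "\<And>t. t \<in> sc_indices n \<Longrightarrow> \<Delta> (x t) = 0"
    and W: "\<And>t. t \<in> sc_indices n \<Longrightarrow> \<Delta> (tensor_act n p h x t) = tensor_act n p h v t"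
  shows "\<exists>M. \<forall>t\<in>sc_indices n. v t = tensor_dact n M x t"
proof -
  let ?p = "\<lambda>i j. p i j / q" and ?k = "\<Delta> q / q"
  have inv': "scaled_inverse n ?p h 1"
    using inv q unfolding scaled_inverse_def
    by (simp add: sum_divide_distrib[symmetric])
  have act: "tensor_act n p h y t = q * tensor_act n ?p h y t" for y t
    using q by (cases t) (simp add: tensor_act_def sum_distrib_left)
  have act_diff: "tensor_act n ?p h (\<lambda>t. v t - ?k * x t) t
      = tensor_act n ?p h v t - ?k * tensor_act n ?p h x t" for t
    by (cases t) (simp add: tensor_act_def sum_subtractf right_diff_distrib sum_distrib_left
        ac_simps)
  have W': "\<Delta> (tensor_act n ?p h x t) = tensor_act n ?p h (\<lambda>t. v t - ?k * x t) t"
    if "t \<in> sc_indices n" for t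
  proof -
    have "q * \<Delta> (tensor_act n ?p h x t) + tensor_act n ?p h x t * \<Delta> q = q * tensor_act n ?p h v t"
      using W[OF that] unfolding act mult .
    then show ?thesis unfolding act_diff using q by (simp add: field_simps)
  qed
  let ?M = "\<lambda>a i. \<Sum>k<n. \<Delta> (h a k) * ?p k i"
  \<comment> \<open>A scalar matrix acts on \<open>x\<close> by two input terms minus one output
    term, hence by that same scalar; adding it to \<open>?M\<close> accounts for
    \<open>?k\<close>.\<close>
  have "v t = tensor_dact n (\<lambda>a i. ?M a i + (if a = i then ?k else 0)) x t"
    if t: "t \<in> sc_indices n" for t
  proof -
    obtain i j l where t_eq: "t = (i, j, l)" by (cases t)
    with t have lt: "i < n" "j < n" "l < n" by (auto simp: sc_indices_def)
    have "v t = tensor_dact n ?M x t + ?k * x t"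
      using tensor_dact_of_transport_inverse[OF inv' x W' t] by (metis diff_add_cancel)
    also have "\<dots> = tensor_dact n (\<lambda>a i. ?M a i + (if a = i then ?k else 0)) x t"
      unfolding tensor_dact_def t_eq prod.case distrib_right sum.distrib sum_delta_mult[OF lt(1)]
        sum_delta_mult[OF lt(2)] sum_delta_mult[OF lt(3)] by simp
    finally show ?thesis .
  qed
  then show ?thesis by blast
qed

end

section \<open>Adjugate matrices and the generic group element\<close>

lemma scaled_inverse_adj:
  fixes h :: "nat \<Rightarrow> nat \<Rightarrow> 'a::comm_ring_1"
  shows "scaled_inverse n (\<lambda>i j. adj_mat (mat n n (\<lambda>(i, j). h i j)) $$ (i, j)) h
    (det (mat n n (\<lambda>(i, j). h i j)))"
proof -
  let ?H = "mat n n (\<lambda>(i, j). h i j)"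
  have H: "?H \<in> carrier_mat n n" by simp
  note adj = adj_mat[OF H]
  have 1: "(\<Sum>c<n. adj_mat ?H $$ (i, c) * h c j) = (if i = j then det ?H else 0)"
    if "i < n" "j < n" for i j
  proof -
    have "(\<Sum>c<n. adj_mat ?H $$ (i, c) * h c j) = (adj_mat ?H * ?H) $$ (i, j)"
      using that adj(1) by (auto simp: scalar_prod_def atLeast0LessThan intro!: sum.cong)
    then show ?thesis unfolding adj(3) using that by simp
  qed
  have 2: "(\<Sum>c<n. h i c * adj_mat ?H $$ (c, j)) = (if i = j then det ?H else 0)"
    if "i < n" "j < n" for i j
  proof -
    have "(\<Sum>c<n. h i c * adj_mat ?H $$ (c, j)) = (?H * adj_mat ?H) $$ (i, j)"
      using that adj(1) by (auto simp: scalar_prod_def atLeast0LessThan intro!: sum.cong)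
    then show ?thesis unfolding adj(2) using that by simp
  qed
  show ?thesis unfolding scaled_inverse_def by (intro allI impI conjI 1 2)
qed

lemma scaled_inverse_smult:
  "scaled_inverse n p h q \<Longrightarrow> scaled_inverse n (\<lambda>i j. r * p i j) h (r * q)"
  unfolding scaled_inverse_def
  by (auto simp: mult.left_commute[of _ r] mult.assoc simp flip: sum_distrib_left)

lemma scaled_inverse_unique:
  assumes p: "scaled_inverse n p h 1" and p': "scaled_inverse n p' h 1" and "i < n" "j < n"
  shows "p i j = p' i j"
proof -
  have "(\<Sum>c<n. p i c * (\<Sum>d<n. h c d * p' d j)) = (\<Sum>c<n. (if c = j then 1 else 0) * p i c)"
    using p' assms(3,4) by (intro sum.cong) (auto simp: scaled_inverse_def)
  moreover have "(\<Sum>c<n. p i c * (\<Sum>d<n. h c d * p' d j)) = (\<Sum>d<n. (if i = d then 1 else 0) * p' d j)"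
    unfolding sum_contract' using p assms(3,4)
    by (intro sum.cong) (auto simp: scaled_inverse_def)
  ultimately show ?thesis using assms(3,4) by (simp only: sum_delta_mult mult_1)
qed

text \<open>The extra scalar variable makes every pair of mutually inverse matrices a specialisation of
  the generic pair.\<close>

lemma generic_scaled_inverse:
  obtains p h :: "nat \<Rightarrow> nat \<Rightarrow> (nat, 'k::field) mpoly" and q
  where "scaled_inverse n p h q"
    and "\<And>p0 h0. scaled_inverse n p0 h0 1 \<Longrightarrow> \<exists>u. mpoly_eval u q = 1 \<and>
      (\<forall>i<n. \<forall>j<n. mpoly_eval u (p i j) = p0 i j \<and> mpoly_eval u (h i j) = h0 i j)"
proof -
  \<comment> \<open>Variable 0 plays the role of the inverse determinant; the other variables are
    the matrix entries, numbered through \<open>prod_encode\<close>.\<close>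
  define h :: "nat \<Rightarrow> nat \<Rightarrow> (nat, 'k) mpoly" where "h i j = mvar (Suc (prod_encode (i, j)))" for i j
  define d where "d = det (mat n n (\<lambda>(i, j). h i j))"
  define p where "p i j = mvar 0 * adj_mat (mat n n (\<lambda>(i, j). h i j)) $$ (i, j)" for i j
  have inv: "scaled_inverse n p h (mvar 0 * d)"
    unfolding p_def d_def by (rule scaled_inverse_smult[OF scaled_inverse_adj])
  have "\<exists>u. mpoly_eval u (mvar 0 * d) = 1 \<and>
      (\<forall>i<n. \<forall>j<n. mpoly_eval u (p i j) = p0 i j \<and> mpoly_eval u (h i j) = h0 i j)"
    if inv0: "scaled_inverse n p0 h0 1" for p0 h0
  proof -
    let ?P = "mat n n (\<lambda>(i, j). p0 i j)" and ?H = "mat n n (\<lambda>(i, j). h0 i j)"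
    have "?P * ?H = 1\<^sub>m n"
      using inv0 by (intro eq_matI) (auto simp: scaled_inverse_def scalar_prod_def atLeast0LessThan)
    then have "det ?P * det ?H = 1" using det_mult[of ?P n ?H] by simp
    then have d0: "det ?H \<noteq> 0" by auto
    define u where "u k = (case k of 0 \<Rightarrow> 1 / det ?H | Suc k \<Rightarrow> case_prod h0 (prod_decode k))" for k
    note hom = comm_ring_hom_mpoly_eval[of u]
    have h: "mpoly_eval u (h i j) = h0 i j" for i j
      by (simp add: h_def mpoly_eval_simps u_def)
    have "map_mat (mpoly_eval u) (mat n n (\<lambda>(i, j). h i j)) = ?H"
      by (intro eq_matI) (auto simp: h)
    then have "mpoly_eval u d = det ?H"
      unfolding d_def comm_ring_hom.hom_det[OF hom, symmetric] by simp
    then have q: "mpoly_eval u (mvar 0 * d) = 1"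
      using d0 by (simp add: mpoly_eval_simps u_def)
    have "scaled_inverse n (\<lambda>i j. mpoly_eval u (p i j)) h0 1"
      using hom_scaled_inverse[OF hom inv] unfolding q h .
    \<comment> \<open>Matching \<open>h\<close> and \<open>q\<close> is enough, since the inverse
      matrix is unique.\<close>
    from scaled_inverse_unique[OF this inv0] h q show ?thesis by blast
  qed
  with inv show ?thesis by (rule that)
qed

section \<open>Descent to the base field\<close>

lemma linear_retraction:
  fixes \<iota> :: "'k::field \<Rightarrow> 'l::field"
  assumes "comm_ring_hom \<iota>"
  obtains \<pi> where "\<And>a b. \<pi> (a + b) = \<pi> a + \<pi> b" "\<And>c z. \<pi> (\<iota> c * z) = c * \<pi> z" "\<pi> 1 = 1"
proof -
  interpret \<iota>: comm_ring_hom \<iota> by fact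
  interpret vs: vector_space "\<lambda>c z. \<iota> c * z"
    by unfold_locales (simp_all add: algebra_simps \<iota>.hom_add \<iota>.hom_mult)
  interpret vs': vector_space "(*) :: 'k \<Rightarrow> 'k \<Rightarrow> 'k"
    by unfold_locales (simp_all add: algebra_simps)
  interpret vsp: vector_space_pair "\<lambda>c z. \<iota> c * z" "(*) :: 'k \<Rightarrow> 'k \<Rightarrow> 'k" ..
  \<comment> \<open>The large field is a vector space over the small one through
    \<open>\<iota>\<close>. Prescribing the value 1 at 1 extends to a linear functional.\<close>
  have "vs.independent {1}" by (simp add: vs.independent_insert)
  from vsp.linear_independent_extend[OF this, of "\<lambda>_. 1"] obtain \<pi>
    where \<pi>: "Vector_Spaces.linear (\<lambda>c z. \<iota> c * z) (*) \<pi>" "\<pi> 1 = 1" by auto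
  interpret l: Vector_Spaces.linear "\<lambda>c z. \<iota> c * z" "(*)" \<pi> by fact
  show ?thesis by (rule that[of \<pi>]) (simp_all add: l.add l.scale \<pi>)
qed

text \<open>\<open>tensor_dact\<close> is linear in the matrix with coefficients from the small
  field, so a linear projection may be applied to \<open>M\<close> entry by entry.\<close>

lemma tensor_dact_descent:
  fixes \<iota> :: "'k::field \<Rightarrow> 'l::field"
  assumes hom: "comm_ring_hom \<iota>"
    and M: "\<And>t. t \<in> sc_indices n \<Longrightarrow> \<iota> (v t) = tensor_dact n M (\<lambda>t. \<iota> (x t)) t"
  shows "\<exists>M0. \<forall>t\<in>sc_indices n. v t = tensor_dact n M0 x t"
proof -
  obtain \<pi> where \<pi>: "\<And>a b. \<pi> (a + b) = \<pi> a + \<pi> b" "\<And>c z. \<pi> (\<iota> c * z) = c * \<pi> z" "\<pi> 1 = 1"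
    using linear_retraction[OF hom] by blast
  have \<pi>': "\<pi> (z * \<iota> c) = \<pi> z * c" for c z using \<pi>(2)[of c z] by (simp add: mult.commute)
  have 0: "\<pi> 0 = 0" using \<pi>(1)[of 0 0] by (metis add_cancel_right_right add_0_right)
  have diff: "\<pi> (a - b) = \<pi> a - \<pi> b" for a b using \<pi>(1)[of "a - b" b] by simp
  have sum: "\<pi> (sum f A) = (\<Sum>i\<in>A. \<pi> (f i))" for f and A :: "nat set"
    by (induction A rule: infinite_finite_induct) (auto simp: \<pi> 0)
  have "v t = tensor_dact n (\<lambda>a i. \<pi> (M a i)) x t" if "t \<in> sc_indices n" for t
  proof -
    have "v t = \<pi> (\<iota> (v t) * 1)" using \<pi>(2)[of "v t" 1] \<pi>(3) by simp
    also have "\<dots> = \<pi> (tensor_dact n M (\<lambda>t. \<iota> (x t)) t)" by (simp only: M[OF that] mult_1_right)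
    also have "\<dots> = tensor_dact n (\<lambda>a i. \<pi> (M a i)) x t"
      by (cases t) (simp only: tensor_dact_def prod.case diff \<pi>(1) sum \<pi>')
    finally show ?thesis .
  qed
  then show ?thesis by blast
qed

section \<open>Coordinates with respect to the basis\<close>

text \<open>The parent locale sees only the image of \<open>e\<close>; injectivity makes the
  numbered family a basis, so that \<open>n\<close> is the dimension.\<close>

locale based_space = finite_dimensional_vector_space s "e ` {..<n}"
  for s :: "'k::field_char_0 \<Rightarrow> 'v::ab_group_add \<Rightarrow> 'v" and n :: nat and e :: "nat \<Rightarrow> 'v" +
  assumes e_inj: "inj_on e {..<n}"
begin

abbreviation "crd \<equiv> coord s n e"
abbreviation "lin \<equiv> Vector_Spaces.linear s s"
abbreviation "J \<equiv> sc_indices n"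

lemma crd_add: "crd (u + v) i = crd u i + crd v i"
  and crd_scale: "crd (s c v) i = c * crd v i"
  and crd_diff: "crd (u - v) i = crd u i - crd v i"
  and crd_zero: "crd 0 i = 0"
  by (simp_all add: coord_def representation_add representation_scale representation_diff
      representation_zero independent_Basis span_Basis)

lemma crd_sum: "crd (sum f A) i = (\<Sum>a\<in>A. crd (f a) i)"
  by (induction A rule: infinite_finite_induct) (auto simp: crd_zero crd_add)

lemma crd_basis: "i < n \<Longrightarrow> j < n \<Longrightarrow> crd (e j) i = (if i = j then 1 else 0)"
  using e_inj by (auto simp: coord_def representation_basis independent_Basis inj_on_eq_iff)

lemma crd_expand: "v = (\<Sum>i<n. s (crd v i) (e i))"
proof -
  have "v = (\<Sum>b\<in>e ` {..<n}. s (representation (e ` {..<n}) v b) b)"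
    by (rule sum_representation_eq[symmetric]) (auto simp: independent_Basis span_Basis)
  also have "\<dots> = (\<Sum>i<n. s (crd v i) (e i))"
    by (simp add: sum.reindex[OF e_inj] coord_def)
  finally show ?thesis .
qed

lemma crd_eqI: "(\<And>i. i < n \<Longrightarrow> crd u i = crd v i) \<Longrightarrow> u = v"
  by (subst crd_expand[of u], subst crd_expand[of v]) (auto intro: sum.cong)

lemma lin_add: "lin f \<Longrightarrow> f (u + v) = f u + f v"
  and lin_scale: "lin f \<Longrightarrow> f (s c v) = s c (f v)"
  and lin_zero: "lin f \<Longrightarrow> f 0 = 0"
  and lin_diff: "lin f \<Longrightarrow> f (u - v) = f u - f v"
  and lin_neg: "lin f \<Longrightarrow> f (- v) = - f v"
  by (simp_all add: Vector_Spaces.linear.axioms linear_iff_module_hom module_hom.add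
      module_hom.scale
      module_hom.zero module_hom.diff module_hom.neg)

lemma lin_sum: "lin f \<Longrightarrow> f (sum g A) = (\<Sum>a\<in>A. f (g a))"
  by (induction A rule: infinite_finite_induct) (auto simp: lin_zero lin_add)

lemma linI: "(\<And>u v. f (u + v) = f u + f v) \<Longrightarrow> (\<And>c v. f (s c v) = s c (f v)) \<Longrightarrow> lin f"
  by unfold_locales auto

lemma lin_expand: "lin f \<Longrightarrow> crd (f v) l = (\<Sum>i<n. crd v i * crd (f (e i)) l)"
  by (subst crd_expand[of v]) (simp add: lin_sum lin_scale crd_sum crd_scale)

lemma lin_eqI:
  assumes "lin f" "lin g" "\<And>i. i < n \<Longrightarrow> f (e i) = g (e i)"
  shows "f v = g v"
  by (rule crd_eqI) (simp add: lin_expand assms)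

lemma bilin_lin:
  assumes "bilinear_map s \<mu>"
  shows "lin (\<lambda>b. \<mu> a b)" "lin (\<lambda>a. \<mu> a b)"
  using assms by (auto simp: bilinear_map_def)

lemma bilin_simps:
  assumes "bilinear_map s \<mu>"
  shows "\<mu> (a + a') b = \<mu> a b + \<mu> a' b" "\<mu> a (b + b') = \<mu> a b + \<mu> a b'"
    "\<mu> (a - a') b = \<mu> a b - \<mu> a' b" "\<mu> a (b - b') = \<mu> a b - \<mu> a b'"
    "\<mu> (- a) b = - \<mu> a b" "\<mu> a (- b) = - \<mu> a b"
    "\<mu> (s c a) b = s c (\<mu> a b)" "\<mu> a (s c b) = s c (\<mu> a b)"
    "\<mu> 0 b = 0" "\<mu> a 0 = 0"
  by (rule lin_add[OF bilin_lin(2)[OF assms]] lin_add[OF bilin_lin(1)[OF assms]]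
      lin_diff[OF bilin_lin(2)[OF assms]] lin_diff[OF bilin_lin(1)[OF assms]]
      lin_neg[OF bilin_lin(2)[OF assms]] lin_neg[OF bilin_lin(1)[OF assms]]
      lin_scale[OF bilin_lin(2)[OF assms]] lin_scale[OF bilin_lin(1)[OF assms]]
      lin_zero[OF bilin_lin(2)[OF assms]] lin_zero[OF bilin_lin(1)[OF assms]])+

lemma bilinearI:
  assumes "\<And>a a' b. \<mu> (a + a') b = \<mu> a b + \<mu> a' b" "\<And>a b b'. \<mu> a (b + b') = \<mu> a b + \<mu> a b'"
    "\<And>c a b. \<mu> (s c a) b = s c (\<mu> a b)" "\<And>c a b. \<mu> a (s c b) = s c (\<mu> a b)"
  shows "bilinear_map s \<mu>"
  unfolding bilinear_map_def using assms by (auto intro!: linI)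

lemma bilin_expand:
  assumes "bilinear_map s \<mu>"
  shows "crd (\<mu> a b) l = (\<Sum>i<n. crd a i * (\<Sum>j<n. crd b j * crd (\<mu> (e i) (e j)) l))"
proof -
  have "crd (\<mu> a b) l = (\<Sum>i<n. crd a i * crd (\<mu> (e i) b) l)"
    by (rule lin_expand[OF bilin_lin(2)[OF assms]])
  then show ?thesis by (simp only: lin_expand[OF bilin_lin(1)[OF assms], of _ b])
qed

section \<open>Structure constants of bilinear maps\<close>

abbreviation "sc \<equiv> struct_consts s n e"
abbreviation "prodc \<equiv> product_of_consts s n e"

lemma sc_apply: "sc \<mu> (i, j, l) = crd (\<mu> (e i) (e j)) l"
  by (simp add: struct_consts_def)

lemma bilin_eqI:
  assumes "bilinear_map s \<mu>" "bilinear_map s \<nu>" "\<And>t. t \<in> J \<Longrightarrow> sc \<mu> t = sc \<nu> t"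
  shows "\<mu> = \<nu>"
proof (intro ext crd_eqI)
  fix a b l assume "l < n"
  then have "crd (\<mu> (e i) (e j)) l = crd (\<nu> (e i) (e j)) l" if "i < n" "j < n" for i j
    using assms(3)[of "(i, j, l)"] that by (simp add: sc_indices_def sc_apply)
  then show "crd (\<mu> a b) l = crd (\<nu> a b) l"
    unfolding bilin_expand[OF assms(1), of a b] bilin_expand[OF assms(2), of a b]
    by (intro sum.cong refl arg_cong2[of _ _ _ _ "(*)"]) auto
qed

lemma bilinear_prodc: "bilinear_map s (prodc y)"
  by (rule bilinearI)
    (simp_all add: product_of_consts_def crd_add crd_scale scale_sum_right
      flip: sum.distrib scale_left_distrib, simp_all add: algebra_simps)

lemma sc_prodc:
  assumes "t \<in> J"
  shows "sc (prodc y) t = y t"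
proof -
  obtain i j l where t: "t = (i, j, l)" by (cases t)
  with assms have lt: "i < n" "j < n" "l < n" by (auto simp: sc_indices_def)
  have "sc (prodc y) t = (\<Sum>i'<n. \<Sum>j'<n. \<Sum>l'<n. crd (e i) i' * crd (e j) j' * y (i', j', l') * crd
      (e l') l)"
    by (simp add: t sc_apply product_of_consts_def crd_sum crd_scale)
  also have "\<dots> = (\<Sum>i'<n. (if i' = i then 1 else 0) * (\<Sum>j'<n. (if j' = j then 1 else 0) *
      (\<Sum>l'<n. (if l' = l then 1 else 0) * y (i', j', l'))))"
    unfolding sum_distrib_left by (intro sum.cong refl) (auto simp: crd_basis lt)
  also have "\<dots> = y t" by (simp only: sum_delta_mult lt t mult_1)
  finally show ?thesis .
qed

section \<open>Linear maps from matrices\<close>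

definition lin_of_mat :: "(nat \<Rightarrow> nat \<Rightarrow> 'k) \<Rightarrow> 'v \<Rightarrow> 'v" where
  "lin_of_mat M v = (\<Sum>i<n. s (crd v i) (\<Sum>a<n. s (M a i) (e a)))"

lemma lin_lin_of_mat: "lin (lin_of_mat M)"
proof (rule linI)
  show "lin_of_mat M (u + v) = lin_of_mat M u + lin_of_mat M v" for u v
    by (simp only: lin_of_mat_def crd_add scale_left_distrib sum.distrib)
  show "lin_of_mat M (s c v) = s c (lin_of_mat M v)" for c v
    by (simp only: lin_of_mat_def crd_scale flip: scale_scale scale_sum_right)
qed

lemma crd_lin_of_mat:
  assumes "l < n"
  shows "crd (lin_of_mat M v) l = (\<Sum>i<n. M l i * crd v i)"
proof -
  have "crd (\<Sum>a<n. s (M a i) (e a)) l = M l i" for i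
  proof -
    have "crd (\<Sum>a<n. s (M a i) (e a)) l = (\<Sum>a<n. (if a = l then 1 else 0) * M a i)"
      unfolding crd_sum crd_scale using assms by (intro sum.cong) (auto simp: crd_basis)
    then show ?thesis using assms by (simp only: sum_delta_mult mult_1)
  qed
  then show ?thesis by (simp add: lin_of_mat_def crd_sum crd_scale mult.commute)
qed

lemma crd_lin_of_mat_basis:
  assumes "l < n" "i < n"
  shows "crd (lin_of_mat M (e i)) l = M l i"
proof -
  have "crd (lin_of_mat M (e i)) l = (\<Sum>k<n. (if k = i then 1 else 0) * M l k)"
    unfolding crd_lin_of_mat[OF assms(1)] using assms(2) by (intro sum.cong) (auto simp: crd_basis)
  then show ?thesis using assms by (simp only: sum_delta_mult mult_1)
qed

lemma crd_comp:
  assumes "lin f" "lin g"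
  shows "crd (f (g (e i))) l = (\<Sum>a<n. crd (f (e a)) l * crd (g (e i)) a)"
  by (subst lin_expand[OF assms(1)]) (simp add: mult.commute)

section \<open>The group action in coordinates\<close>

lemma GL_lin: "g \<in> GL s \<Longrightarrow> lin g"
  and GL_inv: "g \<in> GL s \<Longrightarrow> g (Hilbert_Choice.inv g v) = v" "g \<in> GL s \<Longrightarrow> Hilbert_Choice.inv g (g v)
      = v"
  by (auto simp: GL_def bij_def surj_f_inv_f)

lemma GL_lin_inv: "g \<in> GL s \<Longrightarrow> lin (Hilbert_Choice.inv g)"
  by (rule linI; rule injD[of g])
    (auto simp: GL_inv lin_add[OF GL_lin] lin_scale[OF GL_lin] GL_def bij_is_inj)

lemma GL_I:
  assumes "lin g" "lin h" "\<And>v. g (h v) = v" "\<And>v. h (g v) = v"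
  shows "g \<in> GL s" "Hilbert_Choice.inv g = h"
proof -
  have "g \<circ> h = id" "h \<circ> g = id" using assms by auto
  then have b: "bij g" using o_bij by blast
  with assms(1) show "g \<in> GL s" by (simp add: GL_def)
  show "Hilbert_Choice.inv g = h" using inv_unique_comp \<open>g \<circ> h = id\<close> \<open>h \<circ> g = id\<close> by blast
qed

lemma GL_comp:
  assumes "g \<in> GL s" "g' \<in> GL s"
  shows "g \<circ> g' \<in> GL s" "gl_act g (gl_act g' \<mu>) = gl_act (g \<circ> g') \<mu>"
proof -
  have "lin (g \<circ> g')" "lin (Hilbert_Choice.inv g' \<circ> Hilbert_Choice.inv g)"
    using assms by (auto intro!: linI simp: lin_add[OF GL_lin] lin_scale[OF GL_lin]
        lin_add[OF GL_lin_inv] lin_scale[OF GL_lin_inv])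
  note * = GL_I[OF this]
  show "g \<circ> g' \<in> GL s" by (rule *) (simp_all add: GL_inv assms)
  have "Hilbert_Choice.inv (g \<circ> g') = Hilbert_Choice.inv g' \<circ> Hilbert_Choice.inv g"
      by (rule *) (simp_all add: GL_inv assms)
  then show "gl_act g (gl_act g' \<mu>) = gl_act (g \<circ> g') \<mu>" by (simp add: gl_act_def)
qed

lemma bilinear_gl_act:
  assumes "g \<in> GL s" "bilinear_map s \<mu>"
  shows "bilinear_map s (gl_act g \<mu>)"
  by (rule bilinearI) (simp_all add: gl_act_def lin_add[OF GL_lin] lin_scale[OF GL_lin]
      lin_add[OF GL_lin_inv] lin_scale[OF GL_lin_inv] bilin_simps[OF assms(2)] assms(1))

abbreviation mat_of :: "('v \<Rightarrow> 'v) \<Rightarrow> nat \<Rightarrow> nat \<Rightarrow> 'k" where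
  "mat_of f \<equiv> \<lambda>l i. crd (f (e i)) l"

lemma sc_transport:
  assumes "bilinear_map s \<mu>" "lin f" 
  shows "sc (\<lambda>a b. f (\<mu> (h a) (h b))) t = tensor_act n (mat_of f) (mat_of h) (sc \<mu>) t"
proof (cases t)
  case (fields i j l)
  have "crd (f (\<mu> (h (e i)) (h (e j)))) l = (\<Sum>c<n. mat_of f l c * crd (\<mu> (h (e i)) (h (e j))) c)"
    by (subst lin_expand[OF assms(2)]) (simp add: mult.commute)
  then show ?thesis unfolding bilin_expand[OF assms(1), of "h (e i)" "h (e j)"]
    by (simp add: fields tensor_act_def sc_apply)
qed

lemma scaled_inverse_GL:
  assumes "g \<in> GL s"
  shows "scaled_inverse n (mat_of g) (mat_of (Hilbert_Choice.inv g)) 1"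
  unfolding scaled_inverse_def
  by (simp add: crd_comp[symmetric] GL_lin GL_lin_inv GL_inv assms crd_basis)

lemma tensor_act_cong:
  assumes "\<And>i j. i < n \<Longrightarrow> j < n \<Longrightarrow> p i j = p' i j" "\<And>i j. i < n \<Longrightarrow> j < n \<Longrightarrow> h i j = h' i j"
    "\<And>t. t \<in> J \<Longrightarrow> x t = x' t" "t \<in> J"
  shows "tensor_act n p h x t = tensor_act n p' h' x' t"
proof (cases t)
  case (fields i j l)
  with assms(4) have "i < n" "j < n" "l < n" by (auto simp: sc_indices_def)
  then show ?thesis unfolding fields tensor_act_def prod.case
    by (intro sum.cong arg_cong2[of _ _ _ _ "(*)"] refl assms) (auto simp: sc_indices_def)
qed

text \<open>Let \<open>P\<close> and \<open>H\<close> be the linear maps with matrices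
  \<open>p\<close> and \<open>h\<close>. Then \<open>g = q^-2 P\<close> has inverse
  \<open>q H\<close>, and the scalars cancel because the inverse enters \<open>gl_act\<close>
  twice.\<close>

lemma scaled_inverse_transport:
  assumes inv: "scaled_inverse n p h q" and q: "q \<noteq> 0"
  obtains g where "g \<in> GL s"
    "\<And>\<mu> t. bilinear_map s \<mu> \<Longrightarrow> t \<in> J \<Longrightarrow> tensor_act n p h (sc \<mu>) t = sc (gl_act g \<mu>) t"
proof -
  let ?P = "lin_of_mat p" and ?H = "lin_of_mat h"
  note LP = lin_lin_of_mat[of p] and LH = lin_lin_of_mat[of h]
  have PH: "?P (?H v) = s q v" "?H (?P v) = s q v" for v
  proof -
    have *: "lin_of_mat p' (lin_of_mat h' v) = s q v"
      if "\<And>i j. i < n \<Longrightarrow> j < n \<Longrightarrow> (\<Sum>c<n. p' i c * h' c j) = (if i = j then q else 0)" for p' h' v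
    proof (rule crd_eqI)
      fix l assume l: "l < n"
      have "crd (lin_of_mat p' (lin_of_mat h' v)) l = (\<Sum>c<n. p' l c * (\<Sum>d<n. h' c d * crd v d))"
        unfolding crd_lin_of_mat[OF l] by (intro sum.cong) (auto simp: crd_lin_of_mat)
      also have "\<dots> = (\<Sum>d<n. (if l = d then q else 0) * crd v d)"
        unfolding sum_contract' using that l by (intro sum.cong) auto
      also have "\<dots> = crd (s q v) l" using l by (simp only: sum_delta_mult crd_scale)
      finally show "crd (lin_of_mat p' (lin_of_mat h' v)) l = crd (s q v) l" .
    qed
    show "?P (?H v) = s q v" "?H (?P v) = s q v"
      using inv by (auto simp: scaled_inverse_def intro!: *)
  qed
  let ?g = "\<lambda>v. s (1 / (q * q)) (?P v)" and ?h = "\<lambda>v. s q (?H v)"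
  have lg: "lin ?g" "lin ?h"
    by (auto intro!: linI simp: lin_add[OF LP] lin_scale[OF LP] lin_add[OF LH] lin_scale[OF LH]
        scale_right_distrib mult.commute)
  have gh: "?g (?h v) = v" "?h (?g v) = v" for v
    using q by (simp_all add: lin_scale[OF LP] lin_scale[OF LH] PH)
  show ?thesis
  proof
    show "?g \<in> GL s" by (rule GL_I[OF lg gh])
    fix \<mu> t assume \<mu>: "bilinear_map s \<mu>" and t: "t \<in> J"
    have "Hilbert_Choice.inv ?g = ?h" by (rule GL_I[OF lg gh])
    then have "gl_act ?g \<mu> = (\<lambda>a b. ?P (\<mu> (?H a) (?H b)))"
      using q by (simp add: gl_act_def fun_eq_iff bilin_simps[OF \<mu>] lin_scale[OF LP])
    then have "sc (gl_act ?g \<mu>) t = tensor_act n (mat_of ?P) (mat_of ?H) (sc \<mu>) t"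
      by (simp only: sc_transport[OF \<mu> LP])
    also have "\<dots> = tensor_act n p h (sc \<mu>) t"
      by (rule tensor_act_cong) (simp_all add: crd_lin_of_mat_basis t)
    finally show "tensor_act n p h (sc \<mu>) t = sc (gl_act ?g \<mu>) t" ..
  qed
qed

lemma sc_gl_act:
  assumes "g \<in> GL s" "bilinear_map s \<mu>"
  shows "sc (gl_act g \<mu>) t = tensor_act n (mat_of g) (mat_of (Hilbert_Choice.inv g)) (sc \<mu>) t"
  unfolding gl_act_def by (rule sc_transport[OF assms(2) GL_lin[OF assms(1)]])

end

section \<open>The tangent space of the orbit\<close>

lemma comm_ring_hom_poly: "comm_ring_hom (\<lambda>p. poly p t)"
  by unfold_locales simp_all

lemma comm_ring_hom_Fract: "comm_ring_hom (\<lambda>r. Fract r 1)"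
  by unfold_locales (simp_all add: fract_collapse)

lemma scaled_inverse_delta:
  "scaled_inverse n (\<lambda>i j. if i = j then q else 0) (\<lambda>i j. if i = j then 1 else 0) q"
  unfolding scaled_inverse_def
  by (intro allI impI conjI; simp only: sum_delta_mult mult_1) auto

lemma coeff_tensor_act_const:
  "Polynomial.coeff (tensor_act n (\<lambda>i j. [:p i j:]) (\<lambda>i j. [:h i j:]) z t) k
     = tensor_act n p h (\<lambda>t. Polynomial.coeff (z t) k) t"
  by (cases t) (simp add: tensor_act_def coeff_sum)

text \<open>The first-order expansion of the curve of products obtained by transport along
  \<open>1 + t M\<close>; the multiple of \<open>x\<close> accounts for the determinant of \<open>1 + t M\<close>.\<close>

lemma tensor_act_first_order:
  fixes x :: "sc_index \<Rightarrow> 'k::field_char_0" and M :: "nat \<Rightarrow> nat \<Rightarrow> 'k"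
  obtains p h q c where "scaled_inverse n p h q" "q \<noteq> 0"
    "\<And>t. t \<in> sc_indices n \<Longrightarrow> Polynomial.coeff (tensor_act n p h (\<lambda>t. [:x t:]) t) 0 = x t"
    "\<And>t. t \<in> sc_indices n \<Longrightarrow>
       Polynomial.coeff (tensor_act n p h (\<lambda>t. [:x t:]) t) 1 = tensor_dact n M x t + c * x t"
proof -
  define h where "h i j = [:if i = j then 1 else 0, M i j:]" for i j
  define p where "p i j = adj_mat (mat n n (\<lambda>(i, j). h i j)) $$ (i, j)" for i j
  define q where "q = det (mat n n (\<lambda>(i, j). h i j))"
  have inv: "scaled_inverse n p h q" unfolding p_def q_def by (rule scaled_inverse_adj)
  have h0: "Polynomial.coeff (h i j) 0 = (if i = j then 1 else 0)"
    and h1: "Polynomial.coeff (h i j) 1 = M i j" for i j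
    by (simp_all add: h_def)
  have "map_mat (\<lambda>p. Polynomial.coeff p 0) (mat n n (\<lambda>(i, j). h i j)) = 1\<^sub>m n"
    by (intro eq_matI) (auto simp: h0)
  then have q0: "Polynomial.coeff q 0 = 1"
    unfolding q_def comm_ring_hom.hom_det[OF comm_ring_hom_coeff_0, symmetric] by simp
  then have "q \<noteq> 0" by auto
  \<comment> \<open>At parameter 0 the matrix \<open>p\<close> inverts the identity matrix, hence is
    the identity.\<close>
  have "scaled_inverse n (\<lambda>i j. Polynomial.coeff (p i j) 0) (\<lambda>i j. if i = j then 1 else 0) 1"
    using hom_scaled_inverse[OF comm_ring_hom_coeff_0 inv] unfolding q0 h0 .
  note p0 = scaled_inverse_unique[OF this scaled_inverse_delta]
  \<comment> \<open>Comparing linear coefficients in the matrix identity \<open>p h = q\<close>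
    gives the first-order term of \<open>p\<close>.\<close>
  have p1: "Polynomial.coeff (p i j) 1 = (if i = j then Polynomial.coeff q 1 else 0) - M i j"
    if ij: "i < n" "j < n" for i j
  proof -
    have "Polynomial.coeff (\<Sum>c<n. p i c * h c j) 1 = (if i = j then Polynomial.coeff q 1 else 0)"
      using inv ij unfolding scaled_inverse_def by (simp split: if_splits)
    moreover have "Polynomial.coeff (\<Sum>c<n. p i c * h c j) 1
        = (\<Sum>c<n. (if i = c then 1 else 0) * M c j + (if c
            = j then 1 else 0) * Polynomial.coeff (p i c) 1)"
      unfolding coeff_sum coeff_mult_1 h0 h1 using ij p0 by (intro sum.cong) auto
    ultimately show ?thesis
      unfolding sum.distrib by (simp only: sum_delta_mult ij) (simp add: algebra_simps)
  qed
  show ?thesis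
  proof (rule that[OF inv \<open>q \<noteq> 0\<close>])
    fix t assume t: "t \<in> sc_indices n"
    obtain i j l where t_eq: "t = (i, j, l)" by (cases t)
    with t have lt: "i < n" "j < n" "l < n" by (auto simp: sc_indices_def)
    let ?B = "\<lambda>a c. \<Sum>b<n. h b j * [:x (a, b, c):]"
    let ?A = "\<lambda>c. \<Sum>a<n. h a i * ?B a c"
    have B0: "Polynomial.coeff (?B a c) 0 = x (a, j, c)" for a c
      unfolding coeff_sum coeff_mult_0 h0 coeff_pCons_0 by (simp only: sum_delta_mult lt mult_1)
    have B1: "Polynomial.coeff (?B a c) 1 = (\<Sum>b<n. M b j * x (a, b, c))" for a c
      unfolding coeff_sum coeff_mult_1 h0 h1 by (intro sum.cong) auto
    have A0: "Polynomial.coeff (?A c) 0 = x (i, j, c)" for c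
      unfolding coeff_sum[of "\<lambda>a. h a i * ?B a c"] coeff_mult_0 h0 B0
      by (simp only: sum_delta_mult lt mult_1)
    have A1: "Polynomial.coeff (?A c) 1 = (\<Sum>b<n. M b j * x (i, b, c))
        + (\<Sum>a<n. M a i * x (a, j, c))" for c
      unfolding coeff_sum[of "\<lambda>a. h a i * ?B a c"] coeff_mult_1 h0 h1 B0 B1 sum.distrib
      by (simp only: sum_delta_mult lt mult_1)
    have Y: "tensor_act n p h (\<lambda>t. [:x t:]) t = (\<Sum>c<n. p l c * ?A c)"
      by (simp add: tensor_act_def t_eq)
    have "Polynomial.coeff (\<Sum>c<n. p l c * ?A c) 0 = (\<Sum>c<n. (if l = c then 1 else 0) * x (i, j, c))"
      unfolding coeff_sum[of "\<lambda>c. p l c * ?A c"] coeff_mult_0 A0 using p0 lt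
          by (intro sum.cong) auto
    then show "Polynomial.coeff (tensor_act n p h (\<lambda>t. [:x t:]) t) 0 = x t"
      unfolding Y by (simp only: sum_delta_mult lt mult_1 t_eq)
    have "Polynomial.coeff (\<Sum>c<n. p l c * ?A c) 1
        = (\<Sum>c<n. (if l = c then 1 else 0) * ((\<Sum>b<n. M b j * x (i, b, c))
            + (\<Sum>a<n. M a i * x (a, j, c)))
            + ((if l = c then Polynomial.coeff q 1 else 0) * x (i, j, c) - M l c * x (i, j, c)))"
      unfolding coeff_sum[of "\<lambda>c. p l c * ?A c"] coeff_mult_1 A0 A1 using p0 p1 lt
      by (intro sum.cong) (auto simp: left_diff_distrib)
    \<comment> \<open>The witness for \<open>c\<close> is the linear coefficient of the determinant
      \<open>q\<close>, which enters through the diagonal of \<open>p\<close>.\<close>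
    then show "Polynomial.coeff (tensor_act n p h (\<lambda>t. [:x t:]) t) 1
        = tensor_dact n M x t + Polynomial.coeff q 1 * x t"
      unfolding Y sum.distrib sum_subtractf
      by (simp only: sum_delta_mult lt mult_1 tensor_dact_def t_eq prod.case) simp
  qed
qed

context based_space
begin

section \<open>Tangent directions of the orbit\<close>

context
  fixes x :: "'v \<Rightarrow> 'v \<Rightarrow> 'v"
  assumes x_bil: "bilinear_map s x"
begin

text \<open>Wherever \<open>q\<close> is nonzero the curve lies on the orbit, where \<open>f\<close>
  vanishes. Multiplying by \<open>q\<close> covers the remaining parameters; the product is zero as
  a polynomial over an infinite field, and \<open>q\<close> cancels.\<close>

lemma orbit_ideal_curve:
  assumes inv: "scaled_inverse n p h q" and q: "q \<noteq> 0" and f: "f \<in> orbit_ideal s n e x"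
  shows "mpoly_hom (\<lambda>c. [:c:]) (tensor_act n p h (\<lambda>t. [:sc x t:])) f = 0" (is "?F = 0")
proof -
  have fJ: "f \<in> mpolys J" and f0: "\<And>g. g \<in> GL s \<Longrightarrow> mpoly_eval (sc (gl_act g x)) f = 0"
    using f by (auto simp: orbit_ideal_def)
  have "poly (q * ?F) t = 0" for t
  proof (cases "poly q t = 0")
    case False
    note hom = comm_ring_hom_poly[of t]
    obtain g where g: "g \<in> GL s" "\<And>\<mu> u. bilinear_map s \<mu> \<Longrightarrow> u \<in> J \<Longrightarrow>
        tensor_act n (\<lambda>i j. poly (p i j) t) (\<lambda>i j. poly (h i j) t) (sc \<mu>) u = sc (gl_act g \<mu>) u"
      using scaled_inverse_transport[OF hom_scaled_inverse[OF hom inv] False] by metis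
    have "poly ?F t = mpoly_eval (\<lambda>u. poly (tensor_act n p h (\<lambda>t. [:sc x t:]) u) t) f"
      unfolding hom_mpoly_hom[OF hom comm_ring_hom_pCons] mpoly_eval_eq_hom by simp
    also have "\<dots> = mpoly_eval (sc (gl_act g x)) f"
      unfolding mpoly_eval_eq_hom
      by (rule mpoly_hom_cong[OF fJ]) (simp add: hom_tensor_act[OF hom] g x_bil)
    finally show ?thesis using f0[OF g(1)] by simp
  qed simp
  then have "q * ?F = 0" by (simp flip: poly_all_0_iff_0)
  with q show ?thesis by simp
qed

text \<open>Two curves are used: one has velocity \<open>tensor_dact\<close> plus a multiple of
  \<open>x\<close>, the other has velocity \<open>x\<close>. Linearity in the direction separates
  the two contributions.\<close>

lemma dual_eval_dact_orbit_ideal: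
  assumes f: "f \<in> orbit_ideal s n e x"
  shows "dual_eval (\<lambda>c. c) (sc x) (tensor_dact n M (sc x)) f = 0"
proof -
  have fJ: "f \<in> mpolys J" using f by (simp add: orbit_ideal_def)
  have curve: "dual_eval (\<lambda>c. c) (sc x) v f = 0"
    if "scaled_inverse n p h q" "q \<noteq> 0"
      "\<And>t. t \<in> J \<Longrightarrow> Polynomial.coeff (tensor_act n p h (\<lambda>t. [:sc x t:]) t) 0 = sc x t"
      "\<And>t. t \<in> J \<Longrightarrow> Polynomial.coeff (tensor_act n p h (\<lambda>t. [:sc x t:]) t) 1 = v t"
    for p h q v
    using comm_ring_hom.dual_eval_of_coeffs[OF comm_ring_hom_ident fJ,
        of "tensor_act n p h (\<lambda>t. [:sc x t:])" "sc x" v, OF that(3,4)]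
      orbit_ideal_curve[OF that(1,2) f] by simp
  \<comment> \<open>These matrices give the curve of multiples \<open>(1 + t) x\<close>.\<close>
  let ?p = "\<lambda>i j. if i = j then [:1, 1:] else (0 :: 'k poly)" and ?h = "\<lambda>i j.
      if i = j then 1 else (0 :: 'k poly)"
  have "tensor_act n ?p ?h (\<lambda>t. [:sc x t:]) t = [:sc x t, sc x t:]" if tJ: "t \<in> J" for t
  proof -
    obtain i j l where t: "t = (i, j, l)" "i < n" "j < n" "l < n"
      using tJ by (auto simp: sc_indices_def)
    show ?thesis unfolding tensor_act_def t(1) prod.case
        by (simp only: sum_delta_mult t(2-) mult_1) simp
  qed
  then have x0: "dual_eval (\<lambda>c. c) (sc x) (sc x) f = 0"
    by (intro curve[OF scaled_inverse_delta[of n "[:1, 1:]"]]) simp_all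
  obtain p h q c where "scaled_inverse n p h q" "q \<noteq> 0"
    "\<And>t. t \<in> J \<Longrightarrow> Polynomial.coeff (tensor_act n p h (\<lambda>t. [:sc x t:]) t) 0 = sc x t"
    "\<And>t. t \<in> J \<Longrightarrow>
       Polynomial.coeff (tensor_act n p h (\<lambda>t. [:sc x t:]) t) 1
           = tensor_dact n M (sc x) t + c * sc x t"
    using tensor_act_first_order[of n "sc x" M] by metis
  from curve[OF this] x0 show ?thesis
    by (simp add: comm_ring_hom.dual_eval_add_smult[OF comm_ring_hom_ident])
qed

text \<open>The orbit is given only by the polynomials vanishing on it. Translating \<open>D\<close>
  to the generic point of the orbit makes it a derivation into a field, where it can be extended and
  compared with the generic group element.\<close>

lemma tangent_orbit_imp_dact:
  assumes D: "D \<in> tangent_orbit s n e x"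
  shows "\<exists>M. \<forall>t\<in>J. D (mvar t) = tensor_dact n M (sc x) t"
proof -
  obtain p h :: "nat \<Rightarrow> nat \<Rightarrow> (nat, 'k) mpoly" and q where inv: "scaled_inverse n p h q"
    and spec: "\<And>p0 h0. scaled_inverse n p0 h0 1 \<Longrightarrow> \<exists>u. mpoly_eval u q = 1 \<and>
      (\<forall>i<n. \<forall>j<n. mpoly_eval u (p i j) = p0 i j \<and> mpoly_eval u (h i j) = h0 i j)"
    using generic_scaled_inverse[of n] by metis
  \<comment> \<open>The identity matrix is a specialisation at which \<open>q\<close> becomes
    1.\<close>
  have q: "q \<noteq> 0"
    using spec[OF scaled_inverse_delta] mpoly_eval_simps(4)[of "_ :: nat \<Rightarrow> 'k" 0] by auto
  define v where "v t = D (mvar t)" for t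
  \<comment> \<open>\<open>Y\<close> is the generic point of the orbit and \<open>W\<close> the
    tangent vector of \<open>D\<close> translated to it. \<open>F\<close> substitutes
    \<open>Y\<close>, and \<open>E\<close> is the derivation over \<open>F\<close> that sends the
    coordinates to \<open>W\<close>.\<close>
  define Y where "Y = tensor_act n p h (\<lambda>t. mconst (sc x t))"
  define W where "W = tensor_act n p h (\<lambda>t. mconst (v t))"
  define F where "F = mpoly_hom mconst Y"
  define E where "E = dual_eval mconst Y W"
  interpret mc: comm_ring_hom "mconst :: 'k \<Rightarrow> (nat, 'k) mpoly" by (rule comm_ring_hom_mconst)
  have D_orb: "D f = 0" if "f \<in> orbit_ideal s n e x" for f
    using D that by (simp add: tangent_orbit_def zariski_tangent_def)
  \<comment> \<open>Well-definedness of the derivation on the image of \<open>F\<close>. First,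
    \<open>f\<close> vanishes on the orbit, since every group element is a specialisation of the
    generic one.\<close>
  have E0: "E f = 0" if fJ: "f \<in> mpolys J" and F0: "F f = 0" for f
  proof -
    have f_orb: "mpoly_eval (sc (gl_act g x)) f = 0" if g: "g \<in> GL s" for g
    proof -
      obtain u where u: "\<forall>i<n. \<forall>j<n. mpoly_eval u (p i j) = mat_of g i j
          \<and> mpoly_eval u (h i j) = mat_of (Hilbert_Choice.inv g) i j"
        using spec[OF scaled_inverse_GL[OF g]] by blast
      note hom = comm_ring_hom_mpoly_eval[of u]
      have "mpoly_eval u (F f) = mpoly_eval (\<lambda>t. mpoly_eval u (Y t)) f"
        unfolding F_def hom_mpoly_hom[OF hom comm_ring_hom_mconst] mpoly_eval_simps(4)
        by (simp only: mpoly_eval_eq_hom)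
      also have "\<dots> = mpoly_eval (sc (gl_act g x)) f"
        unfolding mpoly_eval_eq_hom[of "\<lambda>t. mpoly_eval u (Y t)"] mpoly_eval_eq_hom[of
            "sc (gl_act g x)"]
      proof (rule mpoly_hom_cong[OF fJ])
        fix t assume t: "t \<in> J"
        have "mpoly_eval u (Y t)
            = tensor_act n (\<lambda>i j. mpoly_eval u (p i j)) (\<lambda>i j. mpoly_eval u (h i j)) (sc x) t"
          unfolding Y_def hom_tensor_act[OF hom] mpoly_eval_simps(4) ..
        also have "\<dots> = sc (gl_act g x) t"
          unfolding sc_gl_act[OF g x_bil] by (rule tensor_act_cong) (use u t in auto)
        finally show "mpoly_eval u (Y t) = sc (gl_act g x) t" .
      qed
      finally show ?thesis unfolding F0 using mpoly_eval_simps(4)[of u 0] by simp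
    qed
    \<comment> \<open>The factor \<open>q\<close> makes the claim trivial at points \<open>u\<close>
      where the generic matrix does not specialise to a group element.\<close>
    have "mpoly_eval u (q * E f) = 0" for u
    proof (cases "mpoly_eval u q = 0")
      case False
      note hom = comm_ring_hom_mpoly_eval[of u]
      let ?p = "\<lambda>i j. mpoly_eval u (p i j)" and ?h = "\<lambda>i j. mpoly_eval u (h i j)"
      obtain g where g: "g \<in> GL s" "\<And>\<mu> t. bilinear_map s \<mu> \<Longrightarrow> t \<in> J \<Longrightarrow>
          tensor_act n ?p ?h (sc \<mu>) t = sc (gl_act g \<mu>) t"
        using scaled_inverse_transport[OF hom_scaled_inverse[OF hom inv] False] by metis
      \<comment> \<open>\<open>\<sigma>\<close> expresses the action of \<open>g\<close> on
        structure constants in the coordinates. Substituting it preserves vanishing on the orbit, so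
        \<open>D\<close> kills the translated polynomial.\<close>
      define \<sigma> :: "sc_index \<Rightarrow> (sc_index, 'k) mpoly"
        where "\<sigma> = tensor_act n (\<lambda>i j. mconst (?p i j)) (\<lambda>i j. mconst (?h i j)) mvar"
      have \<sigma>: "\<eta> (\<sigma> t) = tensor_act n (\<lambda>i j. \<eta> (mconst (?p i j))) (\<lambda>i j. \<eta> (mconst (?h i j)))
          (\<lambda>t. \<eta> (mvar t)) t" if "comm_ring_hom \<eta>" for t and \<eta> ::
              "(sc_index, 'k) mpoly \<Rightarrow> 'r::comm_ring_1"
        unfolding \<sigma>_def by (rule hom_tensor_act[OF that])
      have \<sigma>J: "\<sigma> t \<in> mpolys J" if "t \<in> J" for t
      proof (cases t)
        case (fields i j l)
        with that show ?thesis unfolding \<sigma>_def tensor_act_def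
          by (auto simp: sc_indices_def intro!: mpolys_sum mpolys_mult mpolys_mconst mpolys_mvar)
      qed
      let ?f = "mpoly_hom mconst \<sigma> f"
      have "?f \<in> orbit_ideal s n e x"
        unfolding orbit_ideal_def
      proof (intro CollectI conjI ballI mpolys_subst[OF fJ \<sigma>J])
        fix g' assume g': "g' \<in> GL s"
        let ?a = "sc (gl_act g' x)"
        have "mpoly_eval ?a ?f = mpoly_eval (\<lambda>t. mpoly_eval ?a (\<sigma> t)) f"
          unfolding hom_mpoly_hom[OF comm_ring_hom_mpoly_eval comm_ring_hom_mconst]
              mpoly_eval_simps(4)
          by (simp only: mpoly_eval_eq_hom)
        also have "\<dots> = mpoly_eval (sc (gl_act (g \<circ> g') x)) f"
          unfolding mpoly_eval_eq_hom[of "\<lambda>t. mpoly_eval ?a (\<sigma> t)"]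
            mpoly_eval_eq_hom[of "sc (gl_act (g \<circ> g') x)"]
        proof (rule mpoly_hom_cong[OF fJ])
          fix t assume "t \<in> J"
          then show "mpoly_eval ?a (\<sigma> t) = sc (gl_act (g \<circ> g') x) t"
            unfolding \<sigma>[OF comm_ring_hom_mpoly_eval] mpoly_eval_simps(4,5)
            using g(2)[OF bilinear_gl_act[OF g' x_bil]] GL_comp(2)[OF g(1) g'] by simp
        qed
        also have "\<dots> = 0" by (rule f_orb[OF GL_comp(1)[OF g(1) g']])
        finally show "mpoly_eval ?a ?f = 0" .
      qed
      then have "D ?f = 0" by (rule D_orb)
      moreover have "D ?f = dual_eval (\<lambda>c. c) (sc x) v ?f"
        unfolding v_def
        by (rule zariski_tangent_eq_dual_eval[OF D[unfolded tangent_orbit_def] mpolys_subst[OF fJ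
            \<sigma>J]])
      \<comment> \<open>The chain rule for the linear substitution \<open>\<sigma>\<close>: base
        point and direction are both transported by \<open>g\<close>.\<close>
      moreover have "dual_eval (\<lambda>c. c) (sc x) v ?f
          = dual_eval (\<lambda>c. c) (tensor_act n ?p ?h (sc x)) (tensor_act n ?p ?h v) f"
      proof -
        let ?\<eta> = "mpoly_hom (\<lambda>c. [:c:]) (\<lambda>t. [:sc x t, v t:])"
        have \<eta>: "comm_ring_hom ?\<eta>"
          by (rule comm_ring_hom.comm_ring_hom_mpoly_hom[OF comm_ring_hom_pCons])
        note \<eta>_simps = comm_ring_hom.mpoly_hom_mconst[OF comm_ring_hom_pCons]
          comm_ring_hom.mpoly_hom_mvar[OF comm_ring_hom_pCons]
        have "?\<eta> ?f = mpoly_hom (\<lambda>c. [:c:]) (\<lambda>t. ?\<eta> (\<sigma> t)) f"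
          unfolding hom_mpoly_hom[OF \<eta> comm_ring_hom_mconst] \<eta>_simps ..
        then show ?thesis
          unfolding dual_eval_def[of _ _ _ ?f] 
          by (simp only:) (rule comm_ring_hom.dual_eval_of_coeffs[OF comm_ring_hom_ident fJ],
              simp_all add: \<sigma>[OF \<eta>] \<eta>_simps coeff_tensor_act_const)
      qed
      moreover have "mpoly_eval u (E f)
          = dual_eval (\<lambda>c. c) (tensor_act n ?p ?h (sc x)) (tensor_act n ?p ?h v) f"
        unfolding E_def mc.hom_dual_eval[OF hom] Y_def W_def hom_tensor_act[OF hom]
            mpoly_eval_simps(4)
        by (simp only:)
      ultimately show ?thesis by (simp add: mpoly_eval_simps)
    qed (simp add: mpoly_eval_simps)
    then have "q * E f = 0" by (rule mpoly_eq_0I)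
    with q show ?thesis by simp
  qed
  define \<iota> :: "(nat, 'k) mpoly \<Rightarrow> (nat, 'k) mpoly fract" where "\<iota> r = Fract r 1" for r
  have \<iota>: "comm_ring_hom \<iota>" unfolding \<iota>_def by (rule comm_ring_hom_Fract)
  interpret \<iota>: comm_ring_hom \<iota> by (rule \<iota>)
  have \<iota>_0: "\<iota> r = 0 \<longleftrightarrow> r = 0" for r
    by (simp add: \<iota>_def Zero_fract_def eq_fract)
  \<comment> \<open>The graph of a derivation from the ring generated by \<open>Y\<close> into the
    fraction field; \<open>E0\<close> and injectivity of \<open>\<iota>\<close> make it
    single-valued.\<close>
  define G where "G = (\<lambda>f. (\<iota> (F f), \<iota> (E f))) ` mpolys J"
  have G_I: "(\<iota> (F f), \<iota> (E f)) \<in> G" if "f \<in> mpolys J" for f using that by (simp add: G_def)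
  interpret F: comm_ring_hom F unfolding F_def by (rule mc.comm_ring_hom_mpoly_hom)
  have FE: "F (f - g) = F f - F g" "E (f - g) = E f - E g" "F (f * g) = F f * F g"
    "E (f * g) = F f * E g + F g * E f" "F (mconst c) = mconst c" "E (mconst c) = 0"
    "F (mvar t) = Y t" "E (mvar t) = W t" for f g c t
    using F.hom_minus[of f g] by (simp_all add: F_def E_def mc.dual_eval_diff mc.dual_eval_mult
        mc.mpoly_hom_mult)
  have "deriv_graph G"
    unfolding deriv_graph_def dual_subring_def
  proof (intro conjI allI impI)
    show "(1, 0) \<in> G" using G_I[OF mpolys_mconst[of 1]] unfolding FE(5,6) by simp
    show "c = 0" if "(0, c) \<in> G" for c
      using that E0 unfolding G_def by (auto simp: eq_commute[of 0] \<iota>_0)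
    fix a a' b b' assume "(a, a') \<in> G" "(b, b') \<in> G"
    then obtain f g where fg: "f \<in> mpolys J" "g \<in> mpolys J" "a = \<iota> (F f)" "a' = \<iota> (E f)"
      "b = \<iota> (F g)" "b' = \<iota> (E g)" unfolding G_def by blast
    show "(a - b, a' - b') \<in> G" "(a * b, a * b' + b * a') \<in> G"
      using G_I[OF mpolys_diff[OF fg(1,2)]] G_I[OF mpolys_mult[OF fg(1,2)]]
      by (simp_all add: fg FE \<iota>.hom_add \<iota>.hom_mult \<iota>.hom_minus)
  qed
  then obtain \<Delta> where \<Delta>: "\<And>a b. \<Delta> (a + b) = \<Delta> a + \<Delta> b" "\<And>a b. \<Delta> (a * b) = a * \<Delta> b + b * \<Delta> a"
    "\<And>a a'. (a, a') \<in> G \<Longrightarrow> \<Delta> a = a'"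
    using derivation_extension by blast
  interpret derivation \<Delta> by unfold_locales (rule \<Delta>)+
  have \<Delta>_const: "\<Delta> (\<iota> (mconst c)) = 0" for c
    using \<Delta>(3)[OF G_I[OF mpolys_mconst[of c]]] by (simp add: FE)
  have \<Delta>_Y: "\<Delta> (\<iota> (Y t)) = \<iota> (W t)" if "t \<in> J" for t
    using \<Delta>(3)[OF G_I[OF mpolys_mvar[OF that]]] by (simp add: FE)
  \<comment> \<open>The extension kills the constants \<open>sc x\<close> and sends the generic
    point to the translate of \<open>v\<close>, which are the hypotheses of
    \<open>tensor_dact_of_transport\<close>.\<close>
  obtain M where M: "\<forall>t\<in>J. \<iota> (mconst (v t)) = tensor_dact n M (\<lambda>t. \<iota> (mconst (sc x t))) t"
    using tensor_dact_of_transport[OF hom_scaled_inverse[OF \<iota> inv], of "\<lambda>t. \<iota> (mconst (sc x t))"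
        "\<lambda>t. \<iota> (mconst (v t))"] q \<Delta>_const \<Delta>_Y
    unfolding Y_def W_def hom_tensor_act[OF \<iota>] by (auto simp: \<iota>_0)
  then show ?thesis
    using tensor_dact_descent[OF comm_ring_hom_comp[OF \<iota> comm_ring_hom_mconst], of n v M "sc x"]
    unfolding v_def by blast
qed

end

end

section \<open>Cocycles and coboundaries\<close>

text \<open>The Leibniz expression polarised: \<open>f\<close> is the outer and \<open>g\<close> the
  inner product, so that adding the form with \<open>f\<close> and \<open>g\<close> exchanged gives
  the linearised equation.\<close>

definition leib_form :: "('v::ab_group_add \<Rightarrow> 'v \<Rightarrow> 'v) \<Rightarrow> ('v \<Rightarrow> 'v \<Rightarrow> 'v) \<Rightarrow> 'v \<Rightarrow> 'v \<Rightarrow> 'v \<Rightarrow> 'v" where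
  "leib_form f g a b c = f (g a b) c - (f (g a c) b + f a (g b c))"

definition leib_consts :: "nat \<Rightarrow> (sc_index \<Rightarrow> 'k::field) \<Rightarrow> (sc_index \<Rightarrow> 'k) \<Rightarrow> nat \<Rightarrow> nat \<Rightarrow> nat \<Rightarrow> nat
    \<Rightarrow> 'k" where
  "leib_consts n f g i j k l = (\<Sum>m<n. g (i, j, m) * f (m, k, l))
     - ((\<Sum>m<n. g (i, k, m) * f (m, j, l)) + (\<Sum>m<n. g (j, k, m) * f (i, m, l)))"

lemma mpoly_eval_leib_poly: "mpoly_eval a (leib_poly n i j k l) = leib_consts n a a i j k l"
proof -
  interpret comm_ring_hom "mpoly_eval a" by (rule comm_ring_hom_mpoly_eval)
  show ?thesis by (simp add: leib_poly_def leib_consts_def hom_minus mpoly_eval_simps)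
qed

lemma dual_eval_leib_poly:
  "dual_eval (\<lambda>c. c) a v (leib_poly n i j k l) = leib_consts n a v i j k l
      + leib_consts n v a i j k l"
  by (simp add: leib_poly_def leib_consts_def dual_eval_simps mpoly_eval_simps sum.distrib
      algebra_simps)

lemma ball_leib_eqs:
  "(\<forall>f\<in>leib_eqs n. P f) \<longleftrightarrow> (\<forall>i<n. \<forall>j<n. \<forall>k<n. \<forall>l<n. P (leib_poly n i j k l))"
  unfolding leib_eqs_def by blast

lemma ball_skew_eqs:
  "(\<forall>f\<in>skew_eqs n. P f) \<longleftrightarrow> (\<forall>i<n. \<forall>j<n. \<forall>l<n. P (mvar (i, j, l) + mvar (j, i, l)))"
  unfolding skew_eqs_def by blast

lemma lie_eqs_mpolys: "leib_eqs n \<union> skew_eqs n \<subseteq> mpolys (sc_indices n)"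
proof -
  have "leib_poly n i j k l \<in> mpolys (sc_indices n)" if "i < n" "j < n" "k < n" "l < n" for i j k l
    unfolding leib_poly_def using that
    by (intro mpolys_diff mpolys_add mpolys_sum mpolys_mult mpolys_mvar) (auto simp: sc_indices_def)
  moreover have "mvar (i, j, l) + mvar (j, i, l) \<in> mpolys (sc_indices n)"
      if "i < n" "j < n" "l < n" for i j l
    using that by (intro mpolys_add mpolys_mvar) (auto simp: sc_indices_def)
  ultimately show ?thesis by (auto simp: leib_eqs_def skew_eqs_def)
qed

context based_space
begin

lemma leib_form_lin:
  assumes "bilinear_map s f" "bilinear_map s g"
  shows "lin (\<lambda>a. leib_form f g a b c)" "lin (\<lambda>b. leib_form f g a b c)"
      "lin (\<lambda>c. leib_form f g a b c)"
  by (auto intro!: linI simp: leib_form_def bilin_simps assms scale_right_distrib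
      scale_right_diff_distrib)

lemma trilinear_eq_0I:
  assumes "\<And>b c. lin (\<lambda>a. T a b c)" "\<And>a c. lin (\<lambda>b. T a b c)" "\<And>a b. lin (\<lambda>c. T a b c)"
    and "\<And>i j k. i < n \<Longrightarrow> j < n \<Longrightarrow> k < n \<Longrightarrow> T (e i) (e j) (e k) = 0"
  shows "T a b c = 0"
proof -
  have 0: "lin (\<lambda>_. 0)" by (rule linI) auto
  have 1: "T (e i) (e j) c = 0" if "i < n" "j < n" for i j c
    by (rule lin_eqI[OF assms(3) 0]) (use assms(4) that in auto)
  have 2: "T (e i) b c = 0" if "i < n" for i b c
    by (rule lin_eqI[OF assms(2) 0]) (use 1 that in auto)
  show ?thesis by (rule lin_eqI[OF assms(1) 0]) (use 2 in auto)
qed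

lemma crd_leib_form:
  assumes "bilinear_map s f" "bilinear_map s g"
  shows "crd (leib_form f g (e i) (e j) (e k)) l = leib_consts n (sc f) (sc g) i j k l"
  unfolding leib_form_def leib_consts_def sc_apply crd_diff crd_add
    lin_expand[OF bilin_lin(2)[OF assms(1)], of "g _ _"] lin_expand[OF bilin_lin(1)[OF assms(1)],
        of _ "g _ _"] ..

text \<open>The criterion serves twice: with \<open>f = g\<close> it gives twice the Leibniz
  identity for the bracket, and with a tangent vector it gives the linearised equations.\<close>

lemma leib_form_sum_zero_iff:
  assumes "bilinear_map s f" "bilinear_map s g"
  shows "(\<forall>a b c. leib_form f g a b c + leib_form g f a b c = 0) \<longleftrightarrow>
    (\<forall>i<n. \<forall>j<n. \<forall>k<n. \<forall>l<n. leib_consts n (sc f) (sc g) i j k l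
        + leib_consts n (sc g) (sc f) i j k l = 0)"
    (is "?L \<longleftrightarrow> ?R")
proof
  assume ?L
  then show ?R by (metis crd_leib_form[OF assms] crd_leib_form[OF assms(2,1)] crd_add crd_zero)
next
  assume R: ?R
  have lin_add: "lin (\<lambda>a. F a + G a)" if "lin F" "lin G" for F G
    using that by (auto intro!: linI simp: lin_add lin_scale scale_right_distrib)
  have "leib_form f g a b c + leib_form g f a b c = 0" for a b c
  proof (rule trilinear_eq_0I[of "\<lambda>a b c. leib_form f g a b c + leib_form g f a b c"])
    fix i j k assume "i < n" "j < n" "k < n"
    with R show "leib_form f g (e i) (e j) (e k) + leib_form g f (e i) (e j) (e k) = 0"
      by (intro crd_eqI) (simp add: crd_add crd_zero crd_leib_form assms)
  qed (intro lin_add leib_form_lin assms)+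
  then show ?L by blast
qed

lemma alternating_skew:
  assumes "bilinear_map s f" "\<forall>a. f a a = 0"
  shows "f b a = - f a b"
proof -
  have "f (a + b) (a + b) = 0" using assms(2) by blast
  then have "f a b + f b a = 0"
    unfolding bilin_simps(1,2)[OF assms(1)] using assms(2) by (simp add: add.commute)
  then show ?thesis by (simp add: eq_neg_iff_add_eq_0 add.commute)
qed

text \<open>The equations on basis vectors express skew symmetry; passing from there to alternation
  divides by 2.\<close>

lemma skew_iff_consts:
  assumes "bilinear_map s f"
  shows "(\<forall>a. f a a = 0) \<longleftrightarrow> (\<forall>i<n. \<forall>j<n. \<forall>l<n. sc f (i, j, l) + sc f (j, i, l) = 0)"
    (is "?L \<longleftrightarrow> ?R")
proof
  assume L: ?L
  have "f a b + f b a = 0" for a b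
    using alternating_skew[OF assms L, of b a] by simp
  then show ?R by (metis sc_apply crd_add crd_zero)
next
  assume R: ?R
  have "f b a = - f a b" for a b
  proof -
    have "(\<lambda>a b. f b a) = (\<lambda>a b. - f a b)"
    proof (rule bilin_eqI)
      show "bilinear_map s (\<lambda>a b. f b a)" "bilinear_map s (\<lambda>a b. - f a b)"
        by (rule bilinearI; simp add: bilin_simps[OF assms] algebra_simps)+
      fix t assume "t \<in> J"
      then obtain i j l where t: "t = (i, j, l)" "i < n" "j < n" "l < n"
          by (auto simp: sc_indices_def)
      have neg: "crd (- v) l = - crd v l" for v
        using crd_diff[of 0 v l] crd_zero by simp
      from R t show "sc (\<lambda>a b. f b a) t = sc (\<lambda>a b. - f a b) t"
        by (simp add: sc_apply neg eq_neg_iff_add_eq_0)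
    qed
    then show ?thesis by meson
  qed
  then have "f a a = - f a a" for a .
  then have "s 2 (f a a) = 0" for a
    using scale_left_distrib[of 1 1 "f a a"] by (metis add.right_inverse one_add_one scale_one)
  then show ?L by (simp add: scale_eq_0_iff)
qed

lemma bilinear_CE_d1:
  assumes "bilinear_map s x" "lin f"
  shows "bilinear_map s (CE_d1 x f)"
  by (rule bilinearI) (simp_all add: CE_d1_def bilin_simps[OF assms(1)] lin_add[OF assms(2)]
      lin_scale[OF assms(2)] scale_right_diff_distrib)

section \<open>The tangent space of the space of all bilinear products\<close>

abbreviation "ambient x \<equiv> zariski_tangent J {} (sc x)"
abbreviation "tmap \<equiv> tangent_to_map2 s n e"

lemma bilinear_tmap: "bilinear_map s (tmap D)"
  unfolding tangent_to_map2_def by (rule bilinear_prodc)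

lemma sc_tmap: "t \<in> J \<Longrightarrow> sc (tmap D) t = D (mvar t)"
  unfolding tangent_to_map2_def by (rule sc_prodc)

lemma tmap_add: "tmap (D + D') = tmap D + tmap D'"
  by (simp add: fun_eq_iff tangent_to_map2_def product_of_consts_def distrib_left scale_left_distrib
      sum.distrib)

lemma tmap_scale: "tmap (tangent_scale c D) = map2_scale s c (tmap D)"
  by (simp add: fun_eq_iff tangent_to_map2_def product_of_consts_def tangent_scale_def
      map2_scale_def
      scale_sum_right mult.left_commute mult.assoc)

lemma dual_eval_tmap:
  assumes "D \<in> ambient x" "f \<in> mpolys J"
  shows "D f = dual_eval (\<lambda>c. c) (sc x) (sc (tmap D)) f"
  unfolding zariski_tangent_eq_dual_eval[OF assms]
  by (rule dual_eval_cong[OF assms(2)]) (simp_all add: sc_tmap)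

text \<open>Without equations, the values on the coordinates are arbitrary;
  \<open>point_deriv\<close> supplies the inverse map.\<close>

lemma tmap_bij: "bij_betw tmap (ambient x) {\<mu>. bilinear_map s \<mu>}"
proof (rule bij_betwI)
  let ?inv = "\<lambda>\<mu>. point_deriv J (sc x) (sc \<mu>)"
  show "tmap \<in> ambient x \<rightarrow> {\<mu>. bilinear_map s \<mu>}" by (simp add: bilinear_tmap)
  show "?inv \<in> {\<mu>. bilinear_map s \<mu>} \<rightarrow> ambient x" by (auto intro!: point_deriv_in_tangent)
  show "?inv (tmap D) = D" if D: "D \<in> ambient x" for D
  proof
    fix f show "?inv (tmap D) f = D f"
    proof (cases "f \<in> mpolys J")
      case False
      then show ?thesis using D by (simp add: point_deriv_def zariski_tangent_def)
    qed (simp add: point_deriv_def dual_eval_tmap[OF D])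
  qed
  show "tmap (?inv \<mu>) = \<mu>" if "\<mu> \<in> {\<mu>. bilinear_map s \<mu>}" for \<mu>
    by (rule bilin_eqI) (use that in \<open>simp_all add: bilinear_tmap sc_tmap point_deriv_mvar\<close>)
qed

end

section \<open>Tangent spaces at a Lie bracket\<close>

locale lie_point = based_space +
  fixes x :: "'b \<Rightarrow> 'b \<Rightarrow> 'b"
  assumes x: "x \<in> Lie_points s n e"
begin

lemma x_bil: "bilinear_map s x"
  using x by (simp add: Lie_points_def)

lemma x_eqs: "f \<in> leib_eqs n \<union> skew_eqs n \<Longrightarrow> mpoly_eval (sc x) f = 0"
  using x ideal_gen_superset[of "leib_eqs n \<union> skew_eqs n" J]
      by (auto simp: Lie_points_def lie_ideal_def)

lemma x_alt: "x a a = 0"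
proof -
  have "sc x (i, j, l) + sc x (j, i, l) = 0" if "i < n" "j < n" "l < n" for i j l
    using x_eqs[of "mvar (i, j, l) + mvar (j, i, l)"] that
    by (auto simp: skew_eqs_def mpoly_eval_simps)
  then show ?thesis using skew_iff_consts[OF x_bil] by blast
qed

lemma x_skew: "x b a = - x a b"
  using alternating_skew[OF x_bil] x_alt by blast

lemma x_jacobi: "x (x a b) c = x (x a c) b + x a (x b c)"
proof -
  have "leib_consts n (sc x) (sc x) i j k l = 0" if "i < n" "j < n" "k < n" "l < n" for i j k l
    using x_eqs[of "leib_poly n i j k l"] that
    by (auto simp: leib_eqs_def mpoly_eval_leib_poly)
  then have "leib_form x x a b c + leib_form x x a b c = 0"
    using leib_form_sum_zero_iff[OF x_bil x_bil] by simp
  then have "s 2 (leib_form x x a b c) = 0"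
    using scale_left_distrib[of 1 1 "leib_form x x a b c"] by simp
  then show ?thesis by (simp add: scale_eq_0_iff leib_form_def)
qed

text \<open>It suffices to test the generators. The linear ones say that the bilinear map is
  alternating, and for such maps the linearised Leibniz identity is the cocycle condition up to
  sign.\<close>

lemma tangent_Lie_iff:
  "D \<in> tangent_Lie s n e x \<longleftrightarrow> D \<in> ambient x \<and> tmap D \<in> CE_Z2 s x"
proof -
  let ?f = "tmap D"
  have f: "bilinear_map s ?f" by (rule bilinear_tmap)
  have "tangent_Lie s n e x = zariski_tangent J (leib_eqs n \<union> skew_eqs n) (sc x)"
    unfolding tangent_Lie_def lie_ideal_def
    by (rule zariski_tangent_ideal_gen[OF lie_eqs_mpolys x_eqs])
  then have "D \<in> tangent_Lie s n e x \<longleftrightarrow>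
      D \<in> ambient x \<and> (\<forall>f\<in>skew_eqs n. D f = 0) \<and> (\<forall>f\<in>leib_eqs n. D f = 0)"
    by (auto simp: zariski_tangent_def)
  also have "\<dots> \<longleftrightarrow> D \<in> ambient x \<and> (\<forall>a. ?f a a = 0) \<and>
      (\<forall>a b c. leib_form x ?f a b c + leib_form ?f x a b c = 0)"
  proof (rule conj_cong[OF refl])
    assume D: "D \<in> ambient x"
    have eval: "(\<forall>g\<in>A. D g = 0) \<longleftrightarrow> (\<forall>g\<in>A. dual_eval (\<lambda>c. c) (sc x) (sc ?f) g = 0)"
      if "A \<subseteq> mpolys J" for A
      by (rule ball_cong[OF refl]) (use that dual_eval_tmap[OF D] in auto)
    have sub: "skew_eqs n \<subseteq> mpolys J" "leib_eqs n \<subseteq> mpolys J" using lie_eqs_mpolys by auto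
    have "(\<forall>g\<in>skew_eqs n. D g = 0) \<longleftrightarrow> (\<forall>a. ?f a a = 0)"
      unfolding skew_iff_consts[OF f] eval[OF sub(1)] by (simp add: ball_skew_eqs dual_eval_simps)
    moreover have "(\<forall>g\<in>leib_eqs n. D g = 0) \<longleftrightarrow>
        (\<forall>a b c. leib_form x ?f a b c + leib_form ?f x a b c = 0)"
      unfolding leib_form_sum_zero_iff[OF x_bil f] eval[OF sub(2)]
      by (simp add: ball_leib_eqs dual_eval_leib_poly add.commute)
    ultimately show "(\<forall>f\<in>skew_eqs n. D f = 0) \<and> (\<forall>f\<in>leib_eqs n. D f = 0) \<longleftrightarrow>
        (\<forall>a. ?f a a = 0) \<and> (\<forall>a b c. leib_form x ?f a b c + leib_form ?f x a b c = 0)" by simp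
  qed
  also have "\<dots> \<longleftrightarrow> D \<in> ambient x \<and> (\<forall>a. ?f a a = 0) \<and> (\<forall>a b c. CE_d2 x ?f a b c = 0)"
  proof (intro conj_cong refl)
    assume alt: "\<forall>a. ?f a a = 0"
    \<comment> \<open>Skew symmetry of \<open>x\<close> and of the cochain moves arguments between
      slots until both expressions have the same six terms.\<close>
    have d2: "CE_d2 x ?f a b c = - (leib_form x ?f a b c + leib_form ?f x a b c)" for a b c
      unfolding CE_d2_def leib_form_def x_skew[of c "?f a b"] x_skew[of b "?f a c"]
        alternating_skew[OF f alt, of "x b c" a] by (simp add: algebra_simps)
    show "(\<forall>a b c. leib_form x ?f a b c + leib_form ?f x a b c = 0) \<longleftrightarrow> (\<forall>a b c. CE_d2 x ?f a b c
        = 0)"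
      unfolding d2 neg_equal_0_iff_equal ..
  qed
  finally show ?thesis using f by (simp add: CE_Z2_def CE_C2_def)
qed

text \<open>By skew symmetry of \<open>x\<close>, the term \<open>- x b (f a)\<close> becomes
  \<open>x (f a) b\<close>. The coboundary is thus the infinitesimal action of \<open>f\<close> on
  the bracket.\<close>

lemma sc_CE_d1:
  assumes "lin f"
  shows "sc (CE_d1 x f) t = tensor_dact n (mat_of f) (sc x) t"
proof (cases t)
  case (fields i j l)
  have "CE_d1 x f (e i) (e j) = x (f (e i)) (e j) + x (e i) (f (e j)) - f (x (e i) (e j))"
    by (simp add: CE_d1_def x_skew[of "e j"])
  then show ?thesis
    by (simp add: fields sc_apply tensor_dact_def crd_add crd_diff
        lin_expand[OF bilin_lin(2)[OF x_bil], of "f _"] lin_expand[OF bilin_lin(1)[OF x_bil], of _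
            "f _"]
        lin_expand[OF assms, of "x _ _"] mult.commute)
qed

text \<open>One direction turns the matrix from \<open>tangent_orbit_imp_dact\<close> into a linear
  map; the other says that velocities of curves in the orbit are tangent.\<close>

lemma tangent_orbit_iff:
  "D \<in> tangent_orbit s n e x \<longleftrightarrow> D \<in> ambient x \<and> tmap D \<in> CE_B2 s x"
proof (intro iffI conjI)
  assume D: "D \<in> tangent_orbit s n e x"
  then show "D \<in> ambient x"
    using zariski_tangent_mono[of "{}" "orbit_ideal s n e x" J "sc x"]
        by (auto simp: tangent_orbit_def)
  obtain M where M: "\<forall>t\<in>J. D (mvar t) = tensor_dact n M (sc x) t"
    using tangent_orbit_imp_dact[OF x_bil D] by blast
  note LM = lin_lin_of_mat[of M]
  have "tmap D = CE_d1 x (lin_of_mat M)"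
  proof (rule bilin_eqI[OF bilinear_tmap bilinear_CE_d1[OF x_bil LM]])
    fix t assume t: "t \<in> J"
    then show "sc (tmap D) t = sc (CE_d1 x (lin_of_mat M)) t"
      unfolding sc_CE_d1[OF LM] sc_tmap[OF t] using M
      by (cases t) (auto simp: tensor_dact_def sc_indices_def crd_lin_of_mat_basis intro!:
          sum.cong arg_cong2[of _ _ _ _ "(-)"] arg_cong2[of _ _ _ _ "(+)"])
  qed
  with LM show "tmap D \<in> CE_B2 s x" by (auto simp: CE_B2_def CE_C1_def)
next
  assume "D \<in> ambient x \<and> tmap D \<in> CE_B2 s x"
  then obtain f where D: "D \<in> ambient x" and f: "lin f" "tmap D = CE_d1 x f"
    by (auto simp: CE_B2_def CE_C1_def)
  have "D g = 0" if g: "g \<in> orbit_ideal s n e x" for g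
  proof -
    have "D g = dual_eval (\<lambda>c. c) (sc x) (sc (tmap D)) g"
      by (rule dual_eval_tmap[OF D]) (use g in \<open>simp add: orbit_ideal_def\<close>)
    also have "sc (tmap D) = tensor_dact n (mat_of f) (sc x)"
      unfolding f(2) by (rule ext) (rule sc_CE_d1[OF f(1)])
    finally show ?thesis using dual_eval_dact_orbit_ideal[OF x_bil g] by simp
  qed
  with D show "D \<in> tangent_orbit s n e x" by (auto simp: tangent_orbit_def zariski_tangent_def)
qed

text \<open>The composite of the two differentials is zero by the Jacobi identity. This makes the
  orbit directions tangent to the scheme of Lie brackets.\<close>

lemma B2_subset_Z2: "CE_B2 s x \<subseteq> CE_Z2 s x"
proof
  fix \<mu> assume "\<mu> \<in> CE_B2 s x"
  then obtain f where f: "lin f" "\<mu> = CE_d1 x f" by (auto simp: CE_B2_def CE_C1_def)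
  have "CE_d2 x \<mu> a b c = 0" for a b c
  proof -
    \<comment> \<open>The Jacobi identity in the form that makes the adjoint action a
      representation.\<close>
    have L: "x (x u v) w = x u (x v w) - x v (x u w)" for u v w
      using x_jacobi[of u v w] x_skew[of v "x u w"] by simp
    have "x (x a b) c = x (x a c) b - x (x b c) a"
      using x_jacobi[of a b c] x_skew[of "x b c" a] by simp
    then have "f (x (x a b) c) = f (x (x a c) b) - f (x (x b c) a)"
      by (simp only: lin_diff[OF f(1)])
    then show ?thesis
      unfolding f(2) CE_d2_def CE_d1_def bilin_simps(4)[OF x_bil]
        L[of a b "f c"] L[of a c "f b"] L[of b c "f a"] by simp
  qed
  then show "\<mu> \<in> CE_Z2 s x"
    using bilinear_CE_d1[OF x_bil f(1)] lin_zero[OF f(1)]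
    by (simp add: CE_Z2_def CE_C2_def f(2)) (simp add: CE_d1_def x_alt)
qed

end

section \<open>Isomorphisms of subquotients\<close>

text \<open>Both tangent space isomorphisms are restrictions of one bijection, so only the subspaces
  have to be matched.\<close>

lemma linear_iso_restrict:
  assumes "bij_betw \<phi> A B" "W \<subseteq> B"
    and "\<And>u v. \<phi> (u + v) = \<phi> u + \<phi> v" "\<And>c u. \<phi> (s1 c u) = s2 c (\<phi> u)"
    and "W' = {u \<in> A. \<phi> u \<in> W}"
  shows "linear_iso s1 W' s2 W \<phi>"
proof -
  have "\<phi> ` W' = \<phi> ` A \<inter> W" unfolding assms(5) by auto
  moreover have "inj_on \<phi> W'"
    using assms(1) by (auto simp: assms(5) bij_betw_def intro: inj_on_subset)
  ultimately have "bij_betw \<phi> W' W"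
    using assms(1,2) by (simp add: bij_betw_def Int_absorb1)
  then show ?thesis by (simp add: linear_iso_def assms(3,4))
qed

text \<open>The condition \<open>closed\<close> puts every coset inside \<open>W1\<close>, where
  \<open>\<phi>\<close> is injective, so distinct cosets have distinct images.\<close>

lemma linear_iso_quotient:
  assumes inj: "inj_on \<phi> W1" and W: "\<phi> ` W1 = W2" and U: "\<phi> ` U1 = U2"
    and add: "\<And>u v. \<phi> (u + v) = \<phi> u + \<phi> v" and scale: "\<And>c u. \<phi> (s1 c u) = s2 c (\<phi> u)"
    and closed: "\<And>u v. u \<in> W1 \<Longrightarrow> v \<in> U1 \<Longrightarrow> u + v \<in> W1"
  shows "linear_iso (quot_scale s1 U1) (quot_space W1 U1) (quot_scale s2 U2) (quot_space W2 U2)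
    (\<lambda>A. \<phi> ` A)"
proof -
  have set_add: "\<phi> ` (A + B) = \<phi> ` A + \<phi> ` B" for A B
    by (force simp: set_plus_def add)
  have coset: "\<phi> ` (w +o U1) = \<phi> w +o U2" for w
    by (force simp: elt_set_plus_def add U[symmetric])
  have "quot_space W1 U1 \<subseteq> Pow W1"
    using closed by (auto simp: quot_space_def elt_set_plus_def)
  then have "inj_on (\<lambda>A. \<phi> ` A) (quot_space W1 U1)"
    using inj_on_image_Pow[OF inj] inj_on_subset by blast
  moreover have "(\<lambda>A. \<phi> ` A) ` quot_space W1 U1 = quot_space W2 U2"
    unfolding quot_space_def image_image coset W[symmetric] by simp
  moreover have "\<phi> ` quot_scale s1 U1 c A = quot_scale s2 U2 c (\<phi> ` A)" for c A
    unfolding quot_scale_def set_add U by (simp add: image_image scale)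
  ultimately show ?thesis by (simp add: linear_iso_def bij_betw_def set_add)
qed

theorem proposition2p6:
  fixes s :: "'k::field_char_0 \<Rightarrow> 'v::ab_group_add \<Rightarrow> 'v"
    and n :: nat
    and e :: "nat \<Rightarrow> 'v"
    and x :: "'v \<Rightarrow> 'v \<Rightarrow> 'v"
  assumes V: "finite_dimensional_vector_space s (e ` {..<n})"
    and e_inj: "inj_on e {..<n}"
    and x: "x \<in> Lie_points s n e"
  shows "linear_iso tangent_scale (tangent_Lie s n e x)
           (map2_scale s) (CE_Z2 s x) (tangent_to_map2 s n e)
       \<and> linear_iso tangent_scale (tangent_orbit s n e x)
           (map2_scale s) (CE_B2 s x) (tangent_to_map2 s n e)
       \<and> linear_iso (quot_scale tangent_scale (tangent_orbit s n e x)) (tangent_stack s n e x)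
           (quot_scale (map2_scale s) (CE_B2 s x)) (CE_H2 s x)
           (\<lambda>A. tangent_to_map2 s n e ` A)"
proof -
  interpret lie_point s n e x
    using V e_inj x by (intro lie_point.intro based_space.intro based_space_axioms.intro
        lie_point_axioms.intro)
  have Z2: "CE_Z2 s x \<subseteq> {\<mu>. bilinear_map s \<mu>}" by (auto simp: CE_Z2_def CE_C2_def)
  have Lie: "tangent_Lie s n e x = {D \<in> ambient x. tmap D \<in> CE_Z2 s x}"
    and orbit: "tangent_orbit s n e x = {D \<in> ambient x. tmap D \<in> CE_B2 s x}"
    by (auto simp: tangent_Lie_iff tangent_orbit_iff)
  have 1: "linear_iso tangent_scale (tangent_Lie s n e x) (map2_scale s) (CE_Z2 s x) tmap"
    by (rule linear_iso_restrict[of tmap "ambient x" "{\<mu>. bilinear_map s \<mu>}"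
        "CE_Z2 s x" tangent_scale "map2_scale s", OF tmap_bij Z2 tmap_add tmap_scale Lie])
  have 2: "linear_iso tangent_scale (tangent_orbit s n e x) (map2_scale s) (CE_B2 s x) tmap"
    by (rule linear_iso_restrict[of tmap "ambient x" "{\<mu>. bilinear_map s \<mu>}"
        "CE_B2 s x" tangent_scale "map2_scale s", OF tmap_bij _ tmap_add tmap_scale orbit]) (use
        B2_subset_Z2 Z2 in blast)
  \<comment> \<open>Coboundaries are cocycles, so orbit directions lie in the tangent space of the
    scheme, which is closed under addition.\<close>
  have closed: "D + D' \<in> tangent_Lie s n e x"
    if "D \<in> tangent_Lie s n e x" "D' \<in> tangent_orbit s n e x" for D D'
  proof -
    have "D' \<in> tangent_Lie s n e x" using that(2) B2_subset_Z2 by (auto simp: Lie orbit)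
    with that(1) show ?thesis
      by (auto simp: tangent_Lie_def zariski_tangent_def algebra_simps)
  qed
  have "linear_iso (quot_scale tangent_scale (tangent_orbit s n e x)) (tangent_stack s n e x)
           (quot_scale (map2_scale s) (CE_B2 s x)) (CE_H2 s x) (\<lambda>A. tmap ` A)"
    unfolding tangent_stack_def CE_H2_def
    by (rule linear_iso_quotient)
      (use 1 2 in \<open>simp_all add: linear_iso_def bij_betw_def tmap_add tmap_scale closed\<close>)
  with 1 2 show ?thesis by blast
qed

end
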